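(* Let $\mathcal{M}$ be an $n$-dimensional paracompact smooth manifold with a linear symmetric (torsion-free) connection $\Gamma$, let $\gamma$ be a symplectic connection on $(\mathcal{T}^*\mathcal{M},\omega)$ compatible with $\Gamma$ (not containing $\hbar$), and let $r$ be the Fedosov Abelian connection series generated by $\gamma$. Let $z\ge2$. Then in every proper Darboux chart: (a) the degree-$z$ component $R_{\gamma+r}[z]$ of the curvature $2$-form of $\gamma+r$ does not contain $\hbar$ and is a sum of terms of the following three kinds only: (1) $f(q)\,(y^1)^{i_1}\cdots(y^n)^{i_n}\,dq^\alpha\wedge dp_\beta$ with $i_1+\cdots+i_n=z$; (2) $f(q)\,(y^1)^{i_1}\cdots(y^n)^{i_n}y^{\tau+n}\,dq^\alpha\wedge dq^\beta$ with $i_1+\cdots+i_n=z-1$; (3) $f(q)\,p_\upsilon\,(y^1)^{i_1}\cdots(y^n)^{i_n}\,dq^\alpha\wedge dq^\beta$ with $i_1+\cdots+i_n=z$; (b) the degree-$(z+1)$ component $r[z+1]$ is a sum of terms of the following three kinds only: (1) $f(q)\,(y^1)^{i_1}\cdots(y^n)^{i_n}\,dp_\alpha$ with $i_1+\cdots+i_n=z+1$; (2) $f(q)\,(y^1)^{i_1}\cdots(y^n)^{i_n}y^{\tau+n}\,dq^\alpha$ with $i_1+\cdots+i_n=z$; (3) $f(q)\,p_\upsilon\,(y^1)^{i_1}\cdots(y^n)^{i_n}\,dq^\alpha$ with $i_1+\cdots+i_n=z+1$. Here $\alpha,\beta,\tau,\upsilon\in\{1,\dots,n\}$, $i_1,\dots,i_n\ge0$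 are integers, and each $f$ denotes a smooth function of the spatial coordinates $q^1,\dots,q^n$ only.
   Context: All objects are smooth; repeated indices are summed. Local coordinates $q^1,\dots,q^n$ on $\mathcal{M}$ induce coordinates $(q^1,\dots,q^n,p_1,\dots,p_n)=(x^1,\dots,x^{2n})$ on $\mathcal{W}=\mathcal{T}^*\mathcal{M}$, where a covector is $p_i dq^i$; such a chart is called a proper Darboux chart. The symplectic form is $\omega=dq^i\wedge dp_i=\tfrac12\omega_{ij}dx^i\wedge dx^j$, and $\omega^{ij}$ is defined by $\omega_{kl}\omega^{lj}=\delta^j_k$. Greek indices run over $1,\dots,n$, capital Latin indices over $n+1,\dots,2n$, lower case Latin over $1,\dots,2n$. A symplectic connection $\gamma$ is a torsion-free linear connection on $\mathcal{W}$ with $\nabla\omega=0$; put $\gamma_{ijk}:=\omega_{il}\gamma^l_{jk}$ (totally symmetric in Darboux coordinates). $\gamma$ is compatible with $\Gamma$ if in every proper Darboux chart: $\gamma_{IJK}=0$; $\gamma_{IJ\alpha}=0$; $\gamma_{I\alpha\beta}(q,p)=-\Gamma^{I-n}_{\alpha\beta}(q)$; and $\gamma_{\alpha\beta\delta}(q,p)=p_\varepsilon f^{\varepsilon}_{\alpha\beta\delta}(q)$ with smooth $f^\varepsilon_{\alpha\beta\delta}$ depending on $q$ only. Fedosov formalism. The Weyl bundle has as sections formal series $a=\sum_{k,l\ge0}\hbar^k a_{k,j_1\dots j_l}y^{j_1}\cdots y^{j_l}$, where $a_{k,j_1\dots j_l}$ are components of smooth totally symmetric covariant tensor fields on $\mathcal{W}$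 and $y^1,\dots,y^{2n}$ are formal commuting variables (components of a tangent vector). A term $\hbar^k$ times a monomial with $l$ factors $y$ has degree $2k+l$; $a[z]$ denotes the degree-$z$ part. The product is $$a\circ b=\sum_{t\ge0}\frac1{t!}\Big(-\frac{i\hbar}2\Big)^t\omega^{i_1j_1}\cdots\omega^{i_tj_t}\frac{\partial^ta}{\partial y^{i_1}\cdots\partial y^{i_t}}\frac{\partial^tb}{\partial y^{j_1}\cdots\partial y^{j_t}},$$ extended to differential forms with values in the Weyl bundle using the wedge product of forms; $[a,b]=a\circ b-(-1)^{m_1m_2}b\circ a$ for an $m_1$-form $a$ and $m_2$-form $b$. Put $\delta a=dx^k\wedge\frac{\partial a}{\partial y^k}$; on an $m$-form homogeneous of degree $l$ in the $y$'s, $\delta^{-1}a=\frac1{l+m}y^k\,\frac{\partial}{\partial x^k}\rfloor a$ if $l+m>0$ and $\delta^{-1}a=0$ if $l+m=0$. In a Darboux chart $\gamma$ also denotes the $1$-form $\frac12\gamma_{ijk}y^iy^jdx^k$; $\partial_\gamma a=da+\frac i\hbar[\gamma,a]$ and $R_\gamma=d\gamma+\frac i\hbar\gamma\circ\gamma$. The Abelian connection series $r$ generated by $\gamma$ is the unique $1$-form with values in the Weyl bundle satisfying $\delta r=R_\gamma+\partial_\gamma r+\frac i\hbar r\circ r$, $\delta^{-1}r=0$ and having only terms of degree $\ge3$. The curvature of $\gamma+r$ is $R_{\gamma+r}=R_\gamma+\partial_\gamma r+\frac i\hbar r\circ r$. *)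

theory Defs
  imports
    "HOL-Analysis.Analysis"
    "HOL-Combinatorics.Multiset_Permutations"
    "HOL-Library.Function_Algebras"
begin

section \<open>Smooth functions and smooth manifolds\<close>

text \<open>\<open>Ck_on\<close> and \<open>smooth_on\<close> are meant for open sets \<open>S\<close>, where the
  Frechet derivative is unique.\<close>

fun Ck_on :: "nat \<Rightarrow> 'a::real_normed_vector set \<Rightarrow> ('a \<Rightarrow> 'b::real_normed_vector) \<Rightarrow> bool" where
  "Ck_on 0 S f \<longleftrightarrow> continuous_on S f"
| "Ck_on (Suc k) S f \<longleftrightarrow>
     (\<forall>x\<in>S. f differentiable (at x)) \<and> (\<forall>v. Ck_on k S (\<lambda>x. frechet_derivative f (at x) v))"

definition smooth_on :: "'a::real_normed_vector set \<Rightarrow> ('a \<Rightarrow> 'b::real_normed_vector) \<Rightarrow> bool" where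
  "smooth_on S f \<longleftrightarrow> (\<forall>k. Ck_on k S f)"

definition pderiv_at :: "'i::finite \<Rightarrow> (real^'i \<Rightarrow> 'b::real_normed_vector) \<Rightarrow> real^'i \<Rightarrow> 'b" where
  "pderiv_at i f x = frechet_derivative f (at x) (axis i 1)"

text \<open>A chart is a pair of a domain and a coordinate map; the values of the map outside the
  domain are irrelevant.\<close>

type_synonym ('a, 'i) chart = "'a set \<times> ('a \<Rightarrow> real^'i)"

abbreviation chart_dom :: "('a, 'i) chart \<Rightarrow> 'a set" where
  "chart_dom \<equiv> fst"

abbreviation coords :: "('a, 'i) chart \<Rightarrow> 'a \<Rightarrow> real^'i" where
  "coords \<equiv> snd"

definition chart_img :: "('a, 'i) chart \<Rightarrow> (real^'i) set" where
  "chart_img c = coords c ` chart_dom c"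

definition transition :: "('a, 'i) chart \<Rightarrow> ('a, 'i) chart \<Rightarrow> real^'i \<Rightarrow> real^'i" where
  "transition c c' x = coords c' (inv_into (chart_dom c) (coords c) x)"

text \<open>With \<open>x\<close> the coordinates of \<open>c\<close> and \<open>x'\<close> those of \<open>c'\<close>,
  \<open>jacobian c c' x a b\<close> is \<open>\<partial>x'\<^sup>a / \<partial>x\<^sup>b\<close> and \<open>hessian c c' x a j k\<close> is
  \<open>\<partial>\<^sup>2x'\<^sup>a / \<partial>x\<^sup>j\<partial>x\<^sup>k\<close>.\<close>

definition jacobian ::
    "('a, 'i::finite) chart \<Rightarrow> ('a, 'i) chart \<Rightarrow> real^'i \<Rightarrow> 'i \<Rightarrow> 'i \<Rightarrow> real" where
  "jacobian c c' x a b = pderiv_at b (\<lambda>u. transition c c' u $ a) x"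

definition hessian ::
    "('a, 'i::finite) chart \<Rightarrow> ('a, 'i) chart \<Rightarrow> real^'i \<Rightarrow> 'i \<Rightarrow> 'i \<Rightarrow> 'i \<Rightarrow> real" where
  "hessian c c' x a j k = pderiv_at j (\<lambda>v. pderiv_at k (\<lambda>u. transition c c' u $ a) v) x"

definition is_chart :: "'a topology \<Rightarrow> ('a, 'i::finite) chart \<Rightarrow> bool" where
  "is_chart X c \<longleftrightarrow> openin X (chart_dom c) \<and> open (chart_img c) \<and>
     homeomorphic_map (subtopology X (chart_dom c)) (top_of_set (chart_img c)) (coords c)"

definition smoothly_compatible :: "('a, 'i::finite) chart \<Rightarrow> ('a, 'i) chart \<Rightarrow> bool" where
  "smoothly_compatible c c' \<longleftrightarrow>
     smooth_on (coords c ` (chart_dom c \<inter> chart_dom c')) (transition c c') \<and>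
     smooth_on (coords c' ` (chart_dom c \<inter> chart_dom c')) (transition c' c)"

definition smooth_manifold :: "'a topology \<Rightarrow> ('a, 'i::finite) chart set \<Rightarrow> bool" where
  "smooth_manifold X A \<longleftrightarrow>
     Hausdorff_space X \<and>
     (\<forall>c\<in>A. is_chart X c) \<and>
     (\<Union>c\<in>A. chart_dom c) = topspace X \<and>
     (\<forall>c\<in>A. \<forall>c'\<in>A. smoothly_compatible c c') \<and>
     (\<forall>c. is_chart X c \<and> (\<forall>c'\<in>A. smoothly_compatible c c') \<longrightarrow> c \<in> A)"

definition paracompact_space :: "'a topology \<Rightarrow> bool" where
  "paracompact_space X \<longleftrightarrow>
     (\<forall>\<U>. (\<forall>U\<in>\<U>. openin X U) \<and> \<Union>\<U> = topspace X \<longrightarrow>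
       (\<exists>\<V>. (\<forall>V\<in>\<V>. openin X V) \<and> \<Union>\<V> = topspace X \<and>
         (\<forall>V\<in>\<V>. \<exists>U\<in>\<U>. V \<subseteq> U) \<and> locally_finite_in X \<V>))"


section \<open>Linear connections\<close>

text \<open>A linear connection is given by its coefficients \<open>G c x l j k\<close>
  (upper index \<open>l\<close>, lower indices \<open>j k\<close>) in all charts of an atlas, subject to the
  inhomogeneous transformation law.\<close>

type_synonym ('a, 'i) conn = "('a, 'i) chart \<Rightarrow> real^'i \<Rightarrow> 'i \<Rightarrow> 'i \<Rightarrow> 'i \<Rightarrow> real"

definition linear_connection :: "('a, 'i::finite) chart set \<Rightarrow> ('a, 'i) conn \<Rightarrow> bool" where
  "linear_connection B G \<longleftrightarrow>
     (\<forall>c\<in>B. \<forall>l j k. smooth_on (chart_img c) (\<lambda>x. G c x l j k)) \<and>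
     (\<forall>c\<in>B. \<forall>c'\<in>B. \<forall>w \<in> chart_dom c \<inter> chart_dom c'. \<forall>m j k.
        (let x = coords c w; x' = coords c' w in
          (\<Sum>l\<in>UNIV. jacobian c c' x m l * G c x l j k) =
          hessian c c' x m j k +
          (\<Sum>a\<in>UNIV. \<Sum>b\<in>UNIV. G c' x' m a b * jacobian c c' x a j * jacobian c c' x b k)))"

definition torsion_free :: "('a, 'i::finite) chart set \<Rightarrow> ('a, 'i) conn \<Rightarrow> bool" where
  "torsion_free B G \<longleftrightarrow> (\<forall>c\<in>B. \<forall>x\<in>chart_img c. \<forall>l j k. G c x l j k = G c x l k j)"

text \<open>\<open>cov_deriv G T x k i j\<close> is \<open>\<nabla>\<^sub>k T\<^sub>i\<^sub>j\<close> in one chart.\<close>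

definition cov_deriv ::
    "(real^'i \<Rightarrow> 'i \<Rightarrow> 'i \<Rightarrow> 'i \<Rightarrow> real) \<Rightarrow> (real^'i \<Rightarrow> 'i::finite \<Rightarrow> 'i \<Rightarrow> real) \<Rightarrow>
     real^'i \<Rightarrow> 'i \<Rightarrow> 'i \<Rightarrow> 'i \<Rightarrow> real" where
  "cov_deriv G T x k i j =
     pderiv_at k (\<lambda>u. T u i j) x
     - (\<Sum>l\<in>UNIV. G x l i k * T x l j) - (\<Sum>l\<in>UNIV. G x l j k * T x i l)"


section \<open>Cotangent bundle, proper Darboux charts, symplectic form\<close>

text \<open>A covector at \<open>w\<close> is the family of its components \<open>\<xi> c $ \<alpha> = p\<^sub>\<alpha>\<close> with respect to
  the coordinate differentials of all charts \<open>c\<close> around \<open>w\<close> (and \<open>0\<close> on all other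
  charts, which makes the representation unique).\<close>

type_synonym ('m, 'n) covector = "('m, 'n) chart \<Rightarrow> real^'n"

definition cotangent_space ::
    "('m, 'n::finite) chart set \<Rightarrow> 'm \<Rightarrow> ('m, 'n) covector set" where
  "cotangent_space A w = {\<xi>.
     (\<forall>c\<in>A. \<forall>c'\<in>A. w \<in> chart_dom c \<inter> chart_dom c' \<longrightarrow>
        (\<forall>\<beta>. \<xi> c' $ \<beta> = (\<Sum>\<alpha>\<in>UNIV. \<xi> c $ \<alpha> * jacobian c' c (coords c' w) \<alpha> \<beta>))) \<and>
     (\<forall>c. \<not> (c \<in> A \<and> w \<in> chart_dom c) \<longrightarrow> \<xi> c = 0)}"

text \<open>The index type of the coordinates \<open>x\<^sup>1, \<dots>, x\<^sup>2\<^sup>n\<close> is \<open>'n + 'n\<close>: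
  \<open>Inl \<alpha>\<close> stands for \<open>\<alpha>\<close> and \<open>Inr \<alpha>\<close> for \<open>\<alpha> + n\<close>.\<close>

type_synonym ('m, 'n) cot_chart = "('m \<times> ('m, 'n) covector, 'n + 'n) chart"

definition darboux_chart ::
    "('m, 'n::finite) chart set \<Rightarrow> ('m, 'n) chart \<Rightarrow> ('m, 'n) cot_chart" where
  "darboux_chart A c =
     ({(w, \<xi>). w \<in> chart_dom c \<and> \<xi> \<in> cotangent_space A w},
      \<lambda>(w, \<xi>). \<chi> i. case i of Inl \<alpha> \<Rightarrow> coords c w $ \<alpha> | Inr \<alpha> \<Rightarrow> \<xi> c $ \<alpha>)"

definition cot_atlas :: "('m, 'n::finite) chart set \<Rightarrow> ('m, 'n) cot_chart set" where
  "cot_atlas A = darboux_chart A ` A"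

definition q_of :: "real^('n + 'n) \<Rightarrow> real^'n" where
  "q_of x = (\<chi> \<alpha>. x $ Inl \<alpha>)"

definition p_of :: "real^('n + 'n) \<Rightarrow> real^'n" where
  "p_of x = (\<chi> \<alpha>. x $ Inr \<alpha>)"

text \<open>The components \<open>\<omega>\<^sub>i\<^sub>j\<close> of \<open>dq\<^sup>\<alpha> \<and> dp\<^sub>\<alpha>\<close>, the same in every proper Darboux chart.\<close>

definition omega :: "real^('n::finite + 'n)^('n + 'n)" where
  "omega = (\<chi> i j. case (i, j) of
       (Inl \<alpha>, Inr \<beta>) \<Rightarrow> (if \<alpha> = \<beta> then 1 else 0)
     | (Inr \<alpha>, Inl \<beta>) \<Rightarrow> (if \<alpha> = \<beta> then - 1 else 0)
     | _ \<Rightarrow> 0)"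

definition omega_inv :: "real^('n::finite + 'n)^('n + 'n)" where
  "omega_inv = matrix_inv omega"

definition symplectic_connection ::
    "('m, 'n::finite) chart set \<Rightarrow> ('m \<times> ('m, 'n) covector, 'n + 'n) conn \<Rightarrow> bool" where
  "symplectic_connection A \<gamma> \<longleftrightarrow>
     linear_connection (cot_atlas A) \<gamma> \<and> torsion_free (cot_atlas A) \<gamma> \<and>
     (\<forall>d\<in>cot_atlas A. \<forall>x\<in>chart_img d. \<forall>k i j.
        cov_deriv (\<gamma> d) (\<lambda>_ i j. omega $ i $ j) x k i j = 0)"

definition lowered ::
    "(real^('n + 'n) \<Rightarrow> 'n + 'n \<Rightarrow> 'n + 'n \<Rightarrow> 'n + 'n \<Rightarrow> real) \<Rightarrow>
     real^('n::finite + 'n) \<Rightarrow> 'n + 'n \<Rightarrow> 'n + 'n \<Rightarrow> 'n + 'n \<Rightarrow> real" where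
  "lowered G x i j k = (\<Sum>l\<in>UNIV. omega $ i $ l * G x l j k)"

definition compatible_connection ::
    "('m, 'n::finite) chart set \<Rightarrow> ('m, 'n) conn \<Rightarrow>
     ('m \<times> ('m, 'n) covector, 'n + 'n) conn \<Rightarrow> bool" where
  "compatible_connection A \<Gamma> \<gamma> \<longleftrightarrow>
     (\<forall>c\<in>A. let d = darboux_chart A c; g = lowered (\<gamma> d) in
        (\<forall>x\<in>chart_img d. \<forall>I J K. g x (Inr I) (Inr J) (Inr K) = 0) \<and>
        (\<forall>x\<in>chart_img d. \<forall>I J \<alpha>. g x (Inr I) (Inr J) (Inl \<alpha>) = 0) \<and>
        (\<forall>x\<in>chart_img d. \<forall>I \<alpha> \<beta>. g x (Inr I) (Inl \<alpha>) (Inl \<beta>) = - \<Gamma> c (q_of x) I \<alpha> \<beta>) \<and>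
        (\<exists>f :: 'n \<Rightarrow> 'n \<Rightarrow> 'n \<Rightarrow> 'n \<Rightarrow> real^'n \<Rightarrow> real.
           (\<forall>\<epsilon> \<alpha> \<beta> \<delta>. smooth_on (chart_img c) (f \<epsilon> \<alpha> \<beta> \<delta>)) \<and>
           (\<forall>x\<in>chart_img d. \<forall>\<alpha> \<beta> \<delta>.
              g x (Inl \<alpha>) (Inl \<beta>) (Inl \<delta>) = (\<Sum>\<epsilon>\<in>UNIV. p_of x $ \<epsilon> * f \<epsilon> \<alpha> \<beta> \<delta> (q_of x)))))"


section \<open>The fibre of the Weyl bundle\<close>

text \<open>A formal series in \<open>\<hbar>\<close> and the commuting variables \<open>y\<^sup>i\<close> is the family \<open>a h M\<close> of its
  coefficients at \<open>\<hbar>\<^sup>h y\<^sup>M\<close>, where the multiset \<open>M\<close> of indices encodes the monomial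
  \<open>y\<^sup>M = (\<Prod>i\<in>#M. y\<^sup>i)\<close>.\<close>

type_synonym 'i weyl = "nat \<Rightarrow> 'i multiset \<Rightarrow> complex"

text \<open>The totally symmetric tensor components \<open>a\<^sub>k\<^sub>,\<^sub>j\<^sub>1\<^sub>\<dots>\<^sub>j\<^sub>l\<close> of the series: the coefficient of a
  monomial is shared equally by all orderings of its indices.\<close>

definition weyl_tensor :: "'i weyl \<Rightarrow> nat \<Rightarrow> 'i list \<Rightarrow> complex" where
  "weyl_tensor a h js = a h (mset js) / of_nat (card (permutations_of_multiset (mset js)))"

definition y_monomial :: "'i multiset \<Rightarrow> 'i weyl" where
  "y_monomial N = (\<lambda>h M. if h = 0 \<and> M = N then 1 else 0)"

definition weyl_scale :: "complex \<Rightarrow> 'i weyl \<Rightarrow> 'i weyl" where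
  "weyl_scale s a = (\<lambda>h M. s * a h M)"

definition y_mult :: "'i \<Rightarrow> 'i weyl \<Rightarrow> 'i weyl" where
  "y_mult i a = (\<lambda>h M. if i \<in># M then a h (M - {#i#}) else 0)"

definition y_deriv :: "'i \<Rightarrow> 'i weyl \<Rightarrow> 'i weyl" where
  "y_deriv i a = (\<lambda>h M. of_nat (count M i + 1) * a h (add_mset i M))"

text \<open>The commutative product of formal series.\<close>

definition series_mult :: "'i weyl \<Rightarrow> 'i weyl \<Rightarrow> 'i weyl" where
  "series_mult a b = (\<lambda>h M. \<Sum>k\<le>h. \<Sum>N | N \<subseteq># M. a k N * b (h - k) (M - N))"

definition weyl_circ :: "('n::finite + 'n) weyl \<Rightarrow> ('n + 'n) weyl \<Rightarrow> ('n + 'n) weyl" where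
  "weyl_circ a b = (\<lambda>h M. \<Sum>t\<le>h. 1 / fact t * (- \<i> / 2) ^ t *
     (\<Sum>is | length is = t. \<Sum>js | length js = t.
        of_real (\<Prod>s<t. omega_inv $ (is ! s) $ (js ! s)) *
        series_mult (foldr y_deriv is a) (foldr y_deriv js b) (h - t) M))"

text \<open>Multiplication by \<open>\<i> / \<hbar>\<close>, only to be applied to series without a term of order
  \<open>\<hbar>\<^sup>0\<close>. See \<open>wcirc_hbar0\<close> and \<open>wcomm_hbar0\<close> below.\<close>

definition i_over_hbar :: "'i weyl \<Rightarrow> 'i weyl" where
  "i_over_hbar a = (\<lambda>h M. \<i> * a (Suc h) M)"

definition degree_part :: "nat \<Rightarrow> 'i weyl \<Rightarrow> 'i weyl" where
  "degree_part z a = (\<lambda>h M. if 2 * h + size M = z then a h M else 0)"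


section \<open>Differential forms with values in the Weyl bundle\<close>

text \<open>In one chart, a \<open>1\<close>-form \<open>a = a\<^sub>k dx\<^sup>k\<close> is given by the components \<open>a x k\<close>, a
  \<open>2\<close>-form \<open>b = 1/2 b\<^sub>j\<^sub>k dx\<^sup>j \<and> dx\<^sup>k\<close> by its antisymmetric components \<open>b x j k\<close>. The
  operations are needed on \<open>1\<close>-forms only. Sums and differences of fibre elements and of forms
  are pointwise.\<close>

type_synonym 'i wform1 = "real^'i \<Rightarrow> 'i \<Rightarrow> 'i weyl"
type_synonym 'i wform2 = "real^'i \<Rightarrow> 'i \<Rightarrow> 'i \<Rightarrow> 'i weyl"

definition wd :: "'i::finite wform1 \<Rightarrow> 'i wform2" where
  "wd a = (\<lambda>x j k h M. pderiv_at j (\<lambda>u. a u k h M) x - pderiv_at k (\<lambda>u. a u j h M) x)"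

definition wcirc :: "('n::finite + 'n) wform1 \<Rightarrow> ('n + 'n) wform1 \<Rightarrow> ('n + 'n) wform2" where
  "wcirc a b = (\<lambda>x j k. weyl_circ (a x j) (b x k) - weyl_circ (a x k) (b x j))"

text \<open>For two \<open>1\<close>-forms the sign in the graded commutator is a plus.\<close>

definition wcomm :: "('n::finite + 'n) wform1 \<Rightarrow> ('n + 'n) wform1 \<Rightarrow> ('n + 'n) wform2" where
  "wcomm a b = wcirc a b - (\<lambda>x j k. weyl_scale ((- 1) ^ (1 * 1)) (wcirc b a x j k))"

definition w_i_over_hbar :: "'i wform2 \<Rightarrow> 'i wform2" where
  "w_i_over_hbar a = (\<lambda>x j k. i_over_hbar (a x j k))"

definition wdelta :: "'i wform1 \<Rightarrow> 'i wform2" where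
  "wdelta a = (\<lambda>x j k. y_deriv j (a x k) - y_deriv k (a x j))"

text \<open>On the part of a \<open>1\<close>-form of degree \<open>l\<close> in the \<open>y\<close>'s, \<open>\<delta>\<^sup>-\<^sup>1\<close> multiplies \<open>y\<^sup>k a\<^sub>k\<close> by
  \<open>1/(l+1)\<close>; here \<open>l = size N\<close>, since \<open>N\<close> is the monomial before multiplication with \<open>y\<^sup>k\<close>.\<close>

definition wdelta_inv :: "'i::finite wform1 \<Rightarrow> real^'i \<Rightarrow> 'i weyl" where
  "wdelta_inv a = (\<lambda>x. \<Sum>k\<in>UNIV. y_mult k (\<lambda>h N. a x k h N / of_nat (size N + 1)))"

lemma weyl_circ_hbar0: "weyl_circ a b 0 M = series_mult a b 0 M"
  by (simp add: weyl_circ_def)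

lemma series_mult_commute: "series_mult a b 0 M = series_mult b a 0 M"
proof -
  have "(\<Sum>N | N \<subseteq># M. a 0 N * b 0 (M - N)) = (\<Sum>N | N \<subseteq># M. a 0 (M - N) * b 0 N)"
    by (rule sum.reindex_bij_witness[where i = "\<lambda>N. M - N" and j = "\<lambda>N. M - N"])
      (auto simp: subset_mset.diff_diff_right subset_mset.add_diff_inverse)
  then show ?thesis
    by (simp add: series_mult_def mult.commute)
qed

lemma wcomm_hbar0: "wcomm a b x j k 0 M = 0"
  by (simp add: wcomm_def wcirc_def weyl_scale_def weyl_circ_hbar0 fun_diff_def
      series_mult_commute[of "b x j"] series_mult_commute[of "b x k"])

lemma wcirc_hbar0: "wcirc a a x j k 0 M = 0"
  by (simp add: wcirc_def weyl_circ_hbar0 fun_diff_def series_mult_commute[of "a x k"])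

text \<open>A global \<open>1\<close>-form with values in the Weyl bundle: the coefficients of
  \<open>\<hbar>\<^sup>h y\<^sup>j\<^sup>1 \<cdots> y\<^sup>j\<^sup>l dx\<^sup>k\<close> are smooth and form a covariant tensor field in \<open>j1, \<dots>, jl, k\<close>.\<close>

definition weyl_one_form ::
    "('a, 'i::finite) chart set \<Rightarrow> (('a, 'i) chart \<Rightarrow> 'i wform1) \<Rightarrow> bool" where
  "weyl_one_form B a \<longleftrightarrow>
     (\<forall>c\<in>B. \<forall>k h M. smooth_on (chart_img c) (\<lambda>x. a c x k h M)) \<and>
     (\<forall>c\<in>B. \<forall>c'\<in>B. \<forall>w \<in> chart_dom c \<inter> chart_dom c'. \<forall>h js k.
        (let x = coords c w; x' = coords c' w in
          weyl_tensor (a c x k) h js =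
          (\<Sum>is | length is = length js. \<Sum>m\<in>UNIV.
             weyl_tensor (a c' x' m) h is *
             of_real ((\<Prod>s<length js. jacobian c c' x (is ! s) (js ! s)) * jacobian c c' x m k))))"


section \<open>Fedosov's Abelian connection\<close>

text \<open>The \<open>1\<close>-form \<open>1/2 \<gamma>\<^sub>i\<^sub>j\<^sub>k y\<^sup>i y\<^sup>j dx\<^sup>k\<close> of a symplectic connection in a proper Darboux chart.\<close>

definition connection_form ::
    "(real^('n + 'n) \<Rightarrow> 'n + 'n \<Rightarrow> 'n + 'n \<Rightarrow> 'n + 'n \<Rightarrow> real) \<Rightarrow> ('n::finite + 'n) wform1" where
  "connection_form G = (\<lambda>x k. \<Sum>i\<in>UNIV. \<Sum>j\<in>UNIV.
     weyl_scale (of_real (1 / 2 * lowered G x i j k)) (y_monomial {#i, j#}))"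

definition w_partial :: "('n::finite + 'n) wform1 \<Rightarrow> ('n + 'n) wform1 \<Rightarrow> ('n + 'n) wform2" where
  "w_partial g a = wd a + w_i_over_hbar (wcomm g a)"

definition w_curv :: "('n::finite + 'n) wform1 \<Rightarrow> ('n + 'n) wform2" where
  "w_curv g = wd g + w_i_over_hbar (wcirc g g)"

text \<open>The curvature \<open>R\<^sub>\<gamma>\<^sub>+\<^sub>r\<close>.\<close>

definition abelian_curv :: "('n::finite + 'n) wform1 \<Rightarrow> ('n + 'n) wform1 \<Rightarrow> ('n + 'n) wform2" where
  "abelian_curv g r = w_curv g + w_partial g r + w_i_over_hbar (wcirc r r)"

definition abelian_connection_series ::
    "('m, 'n::finite) chart set \<Rightarrow> ('m \<times> ('m, 'n) covector, 'n + 'n) conn \<Rightarrow>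
     (('m, 'n) cot_chart \<Rightarrow> ('n + 'n) wform1) \<Rightarrow> bool" where
  "abelian_connection_series A \<gamma> r \<longleftrightarrow>
     weyl_one_form (cot_atlas A) r \<and>
     (\<forall>d\<in>cot_atlas A. \<forall>x\<in>chart_img d.
        (let g = connection_form (\<gamma> d) in
          wdelta (r d) x =
            (w_curv g + w_partial g (r d) + w_i_over_hbar (wcirc (r d) (r d))) x) \<and>
        wdelta_inv (r d) x = 0 \<and>
        (\<forall>k z. z < 3 \<longrightarrow> degree_part z (r d x k) = 0))"


section \<open>The terms occurring in the curvature and in the series\<close>

text \<open>\<open>dx1 i\<close> and \<open>dx2 i j\<close> are the components of \<open>dx\<^sup>i\<close> and \<open>dx\<^sup>i \<and> dx\<^sup>j\<close>.
  The multi-index \<open>(i\<^sub>1, \<dots>, i\<^sub>n)\<close> is a multiset \<open>N\<close> over \<open>'n\<close> with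
  \<open>count N \<alpha> = i\<^sub>\<alpha>\<close>, so that \<open>size N = i\<^sub>1 + \<dots> + i\<^sub>n\<close>, and \<open>y_spatial N\<close> is
  \<open>(y\<^sup>1)\<^bsup>i1\<^esup> \<cdots> (y\<^sup>n)\<^bsup>in\<^esup>\<close>. The set \<open>V\<close> is the range of the spatial coordinates.\<close>

definition dx1 :: "'i \<Rightarrow> 'i \<Rightarrow> complex" where
  "dx1 i k = (if k = i then 1 else 0)"

definition dx2 :: "'i \<Rightarrow> 'i \<Rightarrow> 'i \<Rightarrow> 'i \<Rightarrow> complex" where
  "dx2 i j k l = dx1 i k * dx1 j l - dx1 i l * dx1 j k"

definition y_spatial :: "'n multiset \<Rightarrow> ('n + 'n) multiset" where
  "y_spatial N = image_mset Inl N"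

definition curv_term_1 :: "(real^'n) set \<Rightarrow> nat \<Rightarrow> ('n::finite + 'n) wform2 \<Rightarrow> bool" where
  "curv_term_1 V z T \<longleftrightarrow> (\<exists>(f :: real^'n \<Rightarrow> real) N \<alpha> \<beta>. smooth_on V f \<and> size N = z \<and>
     T = (\<lambda>x k l. weyl_scale (of_real (f (q_of x)) * dx2 (Inl \<alpha>) (Inr \<beta>) k l)
                    (y_monomial (y_spatial N))))"

definition curv_term_2 :: "(real^'n) set \<Rightarrow> nat \<Rightarrow> ('n::finite + 'n) wform2 \<Rightarrow> bool" where
  "curv_term_2 V z T \<longleftrightarrow> (\<exists>(f :: real^'n \<Rightarrow> real) N \<tau> \<alpha> \<beta>. smooth_on V f \<and> size N + 1 = z \<and>
     T = (\<lambda>x k l. weyl_scale (of_real (f (q_of x)) * dx2 (Inl \<alpha>) (Inl \<beta>) k l)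
                    (y_monomial (y_spatial N + {#Inr \<tau>#}))))"

definition curv_term_3 :: "(real^'n) set \<Rightarrow> nat \<Rightarrow> ('n::finite + 'n) wform2 \<Rightarrow> bool" where
  "curv_term_3 V z T \<longleftrightarrow> (\<exists>(f :: real^'n \<Rightarrow> real) N \<upsilon> \<alpha> \<beta>. smooth_on V f \<and> size N = z \<and>
     T = (\<lambda>x k l. weyl_scale (of_real (f (q_of x) * p_of x $ \<upsilon>) * dx2 (Inl \<alpha>) (Inl \<beta>) k l)
                    (y_monomial (y_spatial N))))"

definition series_term_1 :: "(real^'n) set \<Rightarrow> nat \<Rightarrow> ('n::finite + 'n) wform1 \<Rightarrow> bool" where
  "series_term_1 V z T \<longleftrightarrow> (\<exists>(f :: real^'n \<Rightarrow> real) N \<alpha>. smooth_on V f \<and> size N = z + 1 \<and>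
     T = (\<lambda>x k. weyl_scale (of_real (f (q_of x)) * dx1 (Inr \<alpha>) k)
                  (y_monomial (y_spatial N))))"

definition series_term_2 :: "(real^'n) set \<Rightarrow> nat \<Rightarrow> ('n::finite + 'n) wform1 \<Rightarrow> bool" where
  "series_term_2 V z T \<longleftrightarrow> (\<exists>(f :: real^'n \<Rightarrow> real) N \<tau> \<alpha>. smooth_on V f \<and> size N = z \<and>
     T = (\<lambda>x k. weyl_scale (of_real (f (q_of x)) * dx1 (Inl \<alpha>) k)
                  (y_monomial (y_spatial N + {#Inr \<tau>#}))))"

definition series_term_3 :: "(real^'n) set \<Rightarrow> nat \<Rightarrow> ('n::finite + 'n) wform1 \<Rightarrow> bool" where
  "series_term_3 V z T \<longleftrightarrow> (\<exists>(f :: real^'n \<Rightarrow> real) N \<upsilon> \<alpha>. smooth_on V f \<and> size N = z + 1 \<and>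
     T = (\<lambda>x k. weyl_scale (of_real (f (q_of x) * p_of x $ \<upsilon>) * dx1 (Inl \<alpha>) k)
                  (y_monomial (y_spatial N))))"

end

theory Submission
  imports Defs
begin

text \<open>Give weight \<open>1\<close> to each \<open>p\<^sub>\<alpha>\<close>, \<open>y\<^bsup>\<alpha>+n\<^esup>\<close> and \<open>dp\<^sub>\<alpha>\<close>, and weight \<open>0\<close> to \<open>q\<^sup>\<alpha>\<close>,
  \<open>y\<^sup>\<alpha>\<close> and \<open>dq\<^sup>\<alpha>\<close>. Compatibility says that \<open>\<gamma>\<close> is homogeneous of weight \<open>1\<close>. The operators
  \<open>d\<close>, \<open>\<delta>\<close> and \<open>\<delta>\<^sup>-\<^sup>1\<close> preserve the weight, and each contraction with \<open>\<omega>\<^sup>i\<^sup>j\<close> lowers it by \<open>1\<close>. In a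
  commutator of two forms of weight \<open>1\<close>, the single contraction therefore has weight \<open>1\<close>, even
  numbers of contractions cancel, and three or more exceed the available weight \<open>2\<close>. Hence
  \<open>r = \<delta>\<^sup>-\<^sup>1 R\<^sub>\<gamma>\<^sub>+\<^sub>r\<close> propagates, degree by degree, weight \<open>1\<close> and the absence of \<open>\<hbar>\<close>. The
  listed terms are exactly the monomials of weight \<open>1\<close>.\<close>

section \<open>Smooth functions\<close>

lemma frechet_derivative_eq_on_open:
  assumes "open S" "x \<in> S" "\<And>y. y \<in> S \<Longrightarrow> f y = g y" "f differentiable (at x)"
  shows "g differentiable (at x)" "frechet_derivative g (at x) = frechet_derivative f (at x)"
proof -
  have "(f has_derivative frechet_derivative f (at x)) (at x)"
    using assms(4) frechet_derivative_works by blast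
  then have "(g has_derivative frechet_derivative f (at x)) (at x)"
    using has_derivative_transform_within_open assms(1-3) by blast
  then show "g differentiable (at x)" "frechet_derivative g (at x) = frechet_derivative f (at x)"
    by (auto simp: differentiable_def dest: frechet_derivative_at)
qed

text \<open>Derivatives are local, so agreement on the open set is enough. This lets the sum and
  product rules, valid only at points of \<open>S\<close>, replace the derivative functions
  occurring in \<open>Ck_on\<close>.\<close>

lemma Ck_on_cong:
  assumes "open S" "\<And>x. x \<in> S \<Longrightarrow> f x = g x" "Ck_on k S f"
  shows "Ck_on k S g"
  using assms(2,3)
proof (induction k arbitrary: f g)
  case 0
  then show ?case by (simp cong: continuous_on_cong)
next
  case (Suc k)
  have d: "f differentiable (at x)" if "x \<in> S" for x
    using Suc.prems that by simp
  note e = frechet_derivative_eq_on_open[OF assms(1) _ Suc.prems(1) d]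
  have "Ck_on k S (\<lambda>x. frechet_derivative g (at x) v)" for v
    by (rule Suc.IH[of "\<lambda>x. frechet_derivative f (at x) v"])
      (use Suc.prems(2) e(2) in simp_all)
  then show ?case
    using e(1) by simp
qed

text \<open>The base case is that differentiability implies continuity. The product rule keeps
  undifferentiated factors, which must therefore be available one level lower.\<close>

lemma Ck_on_Suc_imp_Ck_on: "Ck_on (Suc k) S f \<Longrightarrow> Ck_on k S f"
proof (induction k arbitrary: f)
  case 0
  then show ?case
    by (auto intro!: continuous_at_imp_continuous_on differentiable_imp_continuous_within)
next
  case (Suc k)
  then show ?case by (metis Ck_on.simps(2))
qed

lemma Ck_on_const: "Ck_on k S (\<lambda>x. c)"
  by (induction k arbitrary: c) (simp_all add: frechet_derivative_const)

lemma Ck_on_add: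
  assumes "open S" "Ck_on k S f" "Ck_on k S g"
  shows "Ck_on k S (\<lambda>x. f x + g x)"
  using assms(2,3)
proof (induction k arbitrary: f g)
  case 0
  then show ?case by (simp add: continuous_on_add)
next
  case (Suc k)
  have h: "((\<lambda>x. f x + g x) has_derivative
      (\<lambda>v. frechet_derivative f (at x) v + frechet_derivative g (at x) v)) (at x)"
    if "x \<in> S" for x
    using that Suc.prems by (intro has_derivative_add) (auto simp: frechet_derivative_works)
  have "Ck_on k S (\<lambda>x. frechet_derivative f (at x) v + frechet_derivative g (at x) v)" for v
    using Suc.prems by (intro Suc.IH) simp_all
  then have "Ck_on k S (\<lambda>x. frechet_derivative (\<lambda>x. f x + g x) (at x) v)" for v
    by (rule Ck_on_cong[OF assms(1), rotated]) (simp flip: frechet_derivative_at[OF h])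
  then show ?case
    using Suc.prems by simp
qed

lemma Ck_on_mult:
  fixes f g :: "'a::real_normed_vector \<Rightarrow> 'b::real_normed_algebra"
  assumes "open S" "Ck_on k S f" "Ck_on k S g"
  shows "Ck_on k S (\<lambda>x. f x * g x)"
  using assms(2,3)
proof (induction k arbitrary: f g)
  case 0
  then show ?case by (simp add: continuous_on_mult)
next
  case (Suc k)
  have d: "f differentiable (at x)" "g differentiable (at x)" if "x \<in> S" for x
    using Suc.prems that by simp_all
  have h: "((\<lambda>x. f x * g x) has_derivative
      (\<lambda>v. f x * frechet_derivative g (at x) v + frechet_derivative f (at x) v * g x)) (at x)"
    if "x \<in> S" for x
    using d[OF that] by (intro has_derivative_mult) (auto simp: frechet_derivative_works)
  have "Ck_on k S f" "Ck_on k S g"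
    using Suc.prems Ck_on_Suc_imp_Ck_on by blast+
  then have "Ck_on k S
      (\<lambda>x. f x * frechet_derivative g (at x) v + frechet_derivative f (at x) v * g x)" for v
    using Suc.prems by (intro Ck_on_add[OF assms(1)] Suc.IH) simp_all
  then have "Ck_on k S (\<lambda>x. frechet_derivative (\<lambda>x. f x * g x) (at x) v)" for v
    by (rule Ck_on_cong[OF assms(1), rotated]) (simp flip: frechet_derivative_at[OF h])
  then show ?case
    using h by (auto simp: differentiable_def)
qed

lemma smooth_on_const: "smooth_on S (\<lambda>x. c)"
  by (simp add: smooth_on_def Ck_on_const)

lemma smooth_on_add:
  "open S \<Longrightarrow> smooth_on S f \<Longrightarrow> smooth_on S g \<Longrightarrow> smooth_on S (\<lambda>x. f x + g x)"
  by (simp add: smooth_on_def Ck_on_add)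

lemma smooth_on_mult:
  fixes f g :: "'a::real_normed_vector \<Rightarrow> 'b::real_normed_algebra"
  shows "open S \<Longrightarrow> smooth_on S f \<Longrightarrow> smooth_on S g \<Longrightarrow> smooth_on S (\<lambda>x. f x * g x)"
  by (simp add: smooth_on_def Ck_on_mult)

lemma smooth_on_imp_differentiable: "smooth_on S f \<Longrightarrow> x \<in> S \<Longrightarrow> f differentiable (at x)"
  unfolding smooth_on_def by (metis Ck_on.simps(2))

lemma smooth_on_pderiv_at: "smooth_on S f \<Longrightarrow> smooth_on S (pderiv_at i f)"
  unfolding smooth_on_def pderiv_at_def by (metis Ck_on.simps(2))

lemma pderiv_at_eq: "(f has_derivative D) (at x) \<Longrightarrow> pderiv_at i f x = D (axis i 1)"
  by (simp add: pderiv_at_def flip: frechet_derivative_at)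

section \<open>Coefficients homogeneous in the momenta\<close>

lemma linear_q_of: "linear q_of" and linear_p_of: "linear p_of"
  by (auto intro!: linearI simp: q_of_def p_of_def vec_eq_iff)

lemma has_derivative_q_of: "(q_of has_derivative q_of) (at x)"
  and has_derivative_p_of: "(p_of has_derivative p_of) (at x)"
  using linear_q_of linear_p_of
  by (auto intro!: bounded_linear_imp_has_derivative simp: linear_conv_bounded_linear)

lemma open_vimage_q_of: "open V \<Longrightarrow> open (q_of -` V)"
  by (intro open_vimage linear_continuous_on)
    (simp_all add: linear_q_of flip: linear_conv_bounded_linear)

lemma q_of_axis [simp]: "q_of (axis (Inl \<alpha>) 1) = axis \<alpha> 1" "q_of (axis (Inr \<alpha>) 1) = 0"
  and p_of_axis [simp]: "p_of (axis (Inl \<alpha>) 1) = 0" "p_of (axis (Inr \<alpha>) 1) = axis \<alpha> 1"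
  by (simp_all add: q_of_def p_of_def vec_eq_iff axis_def)

section \<open>Weights of indices and monomials\<close>

primrec p_weight :: "'n + 'n \<Rightarrow> nat" where
  "p_weight (Inl \<alpha>) = 0"
| "p_weight (Inr \<alpha>) = 1"

definition mset_weight :: "('n + 'n) multiset \<Rightarrow> nat" where
  "mset_weight M = (\<Sum>i\<in>#M. p_weight i)"

lemma mset_weight_simps [simp]:
  "mset_weight {#} = 0"
  "mset_weight (add_mset i M) = p_weight i + mset_weight M"
  "mset_weight (M + N) = mset_weight M + mset_weight N"
  by (simp_all add: mset_weight_def)

text \<open>Homogeneity of degree \<open>1 - w\<close> in \<open>p\<close>, where \<open>w\<close> is the weight of the monomial that the
  coefficient belongs to, so that the whole term has weight \<open>1\<close>.\<close>

definition p_hom :: "(real^'n) set \<Rightarrow> nat \<Rightarrow> (real^('n::finite + 'n) \<Rightarrow> complex) \<Rightarrow> bool" where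
  "p_hom V w g \<longleftrightarrow>
     (if w = 0 then \<exists>f. (\<forall>\<upsilon>. smooth_on V (f \<upsilon>)) \<and>
        (\<forall>x\<in>q_of -` V. g x = of_real (\<Sum>\<upsilon>\<in>UNIV. f \<upsilon> (q_of x) * p_of x $ \<upsilon>))
      else if w = 1 then \<exists>f. smooth_on V f \<and> (\<forall>x\<in>q_of -` V. g x = of_real (f (q_of x)))
      else \<forall>x\<in>q_of -` V. g x = 0)"

lemma p_hom_0I:
  assumes "\<And>\<upsilon>. smooth_on V (f \<upsilon>)"
    and "\<And>x. q_of x \<in> V \<Longrightarrow> g x = of_real (\<Sum>\<upsilon>\<in>UNIV. f \<upsilon> (q_of x) * p_of x $ \<upsilon>)"
  shows "p_hom V 0 g"
  unfolding p_hom_def using assms by auto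

lemma p_hom_1I:
  assumes "smooth_on V f" "\<And>x. q_of x \<in> V \<Longrightarrow> g x = of_real (f (q_of x))"
  shows "p_hom V (Suc 0) g"
  unfolding p_hom_def using assms by auto

lemma p_hom_0E:
  assumes "p_hom V 0 g"
  obtains f where "\<And>\<upsilon>. smooth_on V (f \<upsilon>)"
    and "\<And>x. q_of x \<in> V \<Longrightarrow> g x = of_real (\<Sum>\<upsilon>\<in>UNIV. f \<upsilon> (q_of x) * p_of x $ \<upsilon>)"
  using assms unfolding p_hom_def by auto

lemma p_hom_1E:
  assumes "p_hom V (Suc 0) g"
  obtains f where "smooth_on V f" "\<And>x. q_of x \<in> V \<Longrightarrow> g x = of_real (f (q_of x))"
  using assms unfolding p_hom_def by auto

text \<open>The degree \<open>1 - w\<close> in the momenta is negative here, which leaves only zero.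
  All vanishing statements come from this: excess weight as well as positive powers of \<hbar>,
  which add \<open>2 * h\<close> to \<open>w\<close>.\<close>

lemma p_hom_ge_2: "2 \<le> w \<Longrightarrow> p_hom V w g \<longleftrightarrow> (\<forall>x. q_of x \<in> V \<longrightarrow> g x = 0)"
  unfolding p_hom_def by auto

lemma p_hom_zero:
  assumes "\<And>x. q_of x \<in> V \<Longrightarrow> g x = 0"
  shows "p_hom V w g"
proof -
  have "\<exists>f. smooth_on V f \<and> (\<forall>x\<in>q_of -` V. g x = of_real (f (q_of x)))"
    using assms by (intro exI[of _ "\<lambda>_. 0"]) (simp add: smooth_on_const)
  moreover have "\<exists>f. (\<forall>\<upsilon>. smooth_on V (f \<upsilon>)) \<and>
        (\<forall>x\<in>q_of -` V. g x = of_real (\<Sum>\<upsilon>\<in>UNIV. f \<upsilon> (q_of x) * p_of x $ \<upsilon>))"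
    using assms by (intro exI[of _ "\<lambda>_ _. 0"]) (simp add: smooth_on_const)
  ultimately show ?thesis
    using assms by (simp add: p_hom_def)
qed

lemma p_hom_cong:
  assumes "p_hom V w f" "\<And>x. q_of x \<in> V \<Longrightarrow> g x = f x"
  shows "p_hom V w g"
  using assms unfolding p_hom_def by auto

lemma weight_cases:
  obtains "w = 0" | "w = Suc 0" | "2 \<le> (w::nat)"
  by linarith

lemma p_hom_add:
  assumes V: "open V" and f: "p_hom V w f" and g: "p_hom V w g"
  shows "p_hom V w (\<lambda>x. f x + g x)"
proof (cases w rule: weight_cases)
  case 1
  obtain f' where f': "\<And>\<upsilon>. smooth_on V (f' \<upsilon>)"
      "\<And>x. q_of x \<in> V \<Longrightarrow> f x = of_real (\<Sum>\<upsilon>\<in>UNIV. f' \<upsilon> (q_of x) * p_of x $ \<upsilon>)"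
    using f unfolding 1 by (elim p_hom_0E) (rule that)
  obtain g' where g': "\<And>\<upsilon>. smooth_on V (g' \<upsilon>)"
      "\<And>x. q_of x \<in> V \<Longrightarrow> g x = of_real (\<Sum>\<upsilon>\<in>UNIV. g' \<upsilon> (q_of x) * p_of x $ \<upsilon>)"
    using g unfolding 1 by (elim p_hom_0E) (rule that)
  show ?thesis
    unfolding 1
    by (rule p_hom_0I[of V "\<lambda>\<upsilon> x. f' \<upsilon> x + g' \<upsilon> x"])
      (simp_all add: f' g' smooth_on_add V distrib_right sum.distrib)
next
  case 2
  obtain f' where f': "smooth_on V f'" "\<And>x. q_of x \<in> V \<Longrightarrow> f x = of_real (f' (q_of x))"
    using f unfolding 2 by (elim p_hom_1E) (rule that)
  obtain g' where g': "smooth_on V g'" "\<And>x. q_of x \<in> V \<Longrightarrow> g x = of_real (g' (q_of x))"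
    using g unfolding 2 by (elim p_hom_1E) (rule that)
  show ?thesis
    unfolding 2
    by (rule p_hom_1I[of V "\<lambda>x. f' x + g' x"]) (simp_all add: f' g' smooth_on_add V)
next
  case 3
  then show ?thesis
    using f g by (simp add: p_hom_ge_2)
qed

lemma p_hom_sum:
  assumes "open V" "\<And>i. i \<in> I \<Longrightarrow> p_hom V w (f i)"
  shows "p_hom V w (\<lambda>x. \<Sum>i\<in>I. f i x)"
  using assms(2)
  by (induction I rule: infinite_finite_induct) (auto intro: p_hom_zero p_hom_add[OF assms(1)])

text \<open>A contraction with \<open>\<omega>\<^sup>i\<^sup>j\<close> consumes one unit of weight.\<close>

lemma p_hom_mult:
  assumes V: "open V" and f: "p_hom V a f" and g: "p_hom V b g" and ab: "a + b = Suc w"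
  shows "p_hom V w (\<lambda>x. f x * g x)"
proof -
  have *: "p_hom V w (\<lambda>x. f x * g x)"
    if f: "p_hom V (Suc 0) f" and g: "p_hom V w g" for f g
  proof -
    obtain f' where f': "smooth_on V f'" "\<And>x. q_of x \<in> V \<Longrightarrow> f x = of_real (f' (q_of x))"
      using f by (elim p_hom_1E) (rule that)
    show ?thesis
    proof (cases w rule: weight_cases)
      case 1
      obtain g' where g': "\<And>\<upsilon>. smooth_on V (g' \<upsilon>)"
          "\<And>x. q_of x \<in> V \<Longrightarrow> g x = of_real (\<Sum>\<upsilon>\<in>UNIV. g' \<upsilon> (q_of x) * p_of x $ \<upsilon>)"
        using g unfolding 1 by (elim p_hom_0E) (rule that)
      show ?thesis
        unfolding 1
        by (rule p_hom_0I[of V "\<lambda>\<upsilon> x. f' x * g' \<upsilon> x"])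
          (simp_all add: f' g' smooth_on_mult V sum_distrib_left mult.assoc)
    next
      case 2
      obtain g' where g': "smooth_on V g'" "\<And>x. q_of x \<in> V \<Longrightarrow> g x = of_real (g' (q_of x))"
        using g unfolding 2 by (elim p_hom_1E) (rule that)
      show ?thesis
        unfolding 2
        by (rule p_hom_1I[of V "\<lambda>x. f' x * g' x"]) (simp_all add: f' g' smooth_on_mult V)
    next
      case 3
      then show ?thesis
        using g by (simp add: p_hom_ge_2)
    qed
  qed
  \<comment> \<open>The pair \<open>a = b = 0\<close> is excluded, so some index is
    \<open>1\<close>, which is the case \<open>*\<close>, or at least \<open>2\<close>, which makes
    its factor vanish.\<close>
  consider "a = 1" "b = w" | "b = 1" "a = w" | "2 \<le> a" | "2 \<le> b"
    using ab by linarith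
  then show ?thesis
  proof cases
    case 1
    then show ?thesis using * f g by simp
  next
    case 2
    then show ?thesis using *[of g f] f g by (simp add: mult.commute)
  next
    case 3
    then show ?thesis using f by (intro p_hom_zero) (simp add: p_hom_ge_2)
  next
    case 4
    then show ?thesis using g by (intro p_hom_zero) (simp add: p_hom_ge_2)
  qed
qed

text \<open>A constant is a coefficient with index \<open>1\<close>, which is neutral in
  \<open>p_hom_mult\<close>. The scalar is real because \<open>p_hom\<close> asks for real functions
  of \<open>q\<close>.\<close>

lemma p_hom_scale:
  assumes "open V" "p_hom V w f"
  shows "p_hom V w (\<lambda>x. of_real s * f x)"
  by (rule p_hom_mult[OF assms(1) p_hom_1I assms(2)]) (auto intro: smooth_on_const)

lemma p_hom_diff:
  assumes "open V" "p_hom V w f" "p_hom V w g"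
  shows "p_hom V w (\<lambda>x. f x - g x)"
  using p_hom_add[OF assms(1,2) p_hom_scale[OF assms(1,3), of "- 1"]] by simp

text \<open>Differentiating in \<open>p\<close> lowers the degree in the momenta by one and so
  raises \<open>w\<close> by one; differentiating in \<open>q\<close> only changes the coefficient
  functions. The shift is exactly the weight of the differential that \<open>wd\<close>
  adds.\<close>

lemma p_hom_derivative:
  fixes V :: "(real^'n::finite) set"
  assumes V: "open V" and g: "p_hom V w g"
  shows "q_of x \<in> V \<Longrightarrow> g differentiable (at x)"
    and "p_hom V (w + p_weight j) (pderiv_at j g)"
proof -
  have q: "((\<lambda>u. of_real (f (q_of u)) :: complex) has_derivative
      (\<lambda>v. of_real (frechet_derivative f (at (q_of x)) (q_of v)))) (at x)"
    if "smooth_on V f" "q_of x \<in> V" for f :: "real^'n \<Rightarrow> real" and x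
  proof -
    have "(f has_derivative frechet_derivative f (at (q_of x))) (at (q_of x))"
      using that smooth_on_imp_differentiable frechet_derivative_works by blast
    then show ?thesis
      by (intro has_derivative_of_real has_derivative_compose[OF has_derivative_q_of])
  qed
  have p: "((\<lambda>u. of_real (p_of u $ \<upsilon>) :: complex) has_derivative
      (\<lambda>v. of_real (p_of v $ \<upsilon>))) (at x)" for \<upsilon> x
    using has_derivative_p_of[of x]
    by (intro has_derivative_of_real bounded_linear.has_derivative[OF bounded_linear_vec_nth])
  \<comment> \<open>Along a momentum axis \<open>q_of\<close> is \<open>0\<close>, so the chain rule
    evaluates the derivative of a coefficient function at the zero vector.\<close>
  have lin0: "frechet_derivative f (at u) 0 = 0"
    if "smooth_on V f" "u \<in> V" for f :: "real^'n \<Rightarrow> real" and u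
    using that by (metis smooth_on_imp_differentiable linear_0 linear_frechet_derivative)
  \<comment> \<open>The explicit formula for \<open>g\<close> is known only over \<open>V\<close>;
    openness of the preimage transfers its derivative.\<close>
  have tr: "(g has_derivative D) (at x)"
    if "(f has_derivative D) (at x)" "q_of x \<in> V" "\<And>u. q_of u \<in> V \<Longrightarrow> g u = f u" for f D x
    using that V
    by (intro has_derivative_transform_within_open[OF that(1) open_vimage_q_of[OF V]]) auto
  have "(\<forall>x. q_of x \<in> V \<longrightarrow> g differentiable (at x)) \<and>
      p_hom V (w + p_weight j) (pderiv_at j g)"
  proof (cases w rule: weight_cases)
    case 1
    obtain f where f: "\<And>\<upsilon>. smooth_on V (f \<upsilon>)"
        "\<And>x. q_of x \<in> V \<Longrightarrow> g x = of_real (\<Sum>\<upsilon>\<in>UNIV. f \<upsilon> (q_of x) * p_of x $ \<upsilon>)"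
      using g unfolding 1 by (elim p_hom_0E) (rule that)
    \<comment> \<open>Along a position axis only the second summand of this product rule survives,
      along a momentum axis only the first.\<close>
    define D where "D = (\<lambda>x v. \<Sum>\<upsilon>\<in>UNIV. of_real (f \<upsilon> (q_of x)) * of_real (p_of v $ \<upsilon>) +
      of_real (frechet_derivative (f \<upsilon>) (at (q_of x)) (q_of v)) * of_real (p_of x $ \<upsilon>) :: complex)"
    have "((\<lambda>u. \<Sum>\<upsilon>\<in>UNIV. of_real (f \<upsilon> (q_of u)) * of_real (p_of u $ \<upsilon>)) has_derivative D x) (at x)"
      if "q_of x \<in> V" for x
      unfolding D_def by (intro has_derivative_sum has_derivative_mult q p f that)
    then have gD: "(g has_derivative D x) (at x)" if "q_of x \<in> V" for x
      by (rule tr) (use that f(2) in auto)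
    have pd: "pderiv_at j g x = D x (axis j 1)" if "q_of x \<in> V" for x
      using gD[OF that] by (rule pderiv_at_eq)
    have "p_hom V (w + p_weight j) (pderiv_at j g)"
    proof (cases j)
      case (Inl \<alpha>)
      show ?thesis
        unfolding 1 Inl p_weight.simps add_0
        by (rule p_hom_0I[of V "\<lambda>\<upsilon>. pderiv_at \<alpha> (f \<upsilon>)"])
          (use pd in \<open>simp_all add: f smooth_on_pderiv_at Inl D_def pderiv_at_def\<close>)
    next
      case (Inr \<alpha>)
      have ax: "axis \<alpha> (1::real) $ \<upsilon> = of_bool (\<upsilon> = \<alpha>)" for \<upsilon>
        by (simp add: axis_def)
      have "D x (axis (Inr \<alpha>) 1) = of_real (f \<alpha> (q_of x))" if "q_of x \<in> V" for x
        using that by (simp add: D_def lin0 f ax of_bool_def if_distrib[of complex_of_real] if_distrib[of "\<lambda>t. _ * t"] cong: if_cong)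
      then show ?thesis
        using pd f(1) by (simp add: 1 Inr) (rule p_hom_1I, auto)
    qed
    then show ?thesis
      using gD by (auto simp: differentiable_def)
  next
    case 2
    obtain f where f: "smooth_on V f" "\<And>x. q_of x \<in> V \<Longrightarrow> g x = of_real (f (q_of x))"
      using g unfolding 2 by (elim p_hom_1E) (rule that)
    have gD: "(g has_derivative (\<lambda>v. of_real (frechet_derivative f (at (q_of x)) (q_of v)))) (at x)"
      if "q_of x \<in> V" for x
      by (rule tr[OF q]) (use that f in auto)
    have pd: "pderiv_at j g x = of_real (frechet_derivative f (at (q_of x)) (q_of (axis j 1)))"
      if "q_of x \<in> V" for x
      using gD[OF that] by (rule pderiv_at_eq)
    have "p_hom V (w + p_weight j) (pderiv_at j g)"
    proof (cases j)
      case (Inl \<alpha>)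
      show ?thesis
        unfolding 2 Inl p_weight.simps add_0_right
        by (rule p_hom_1I[of V "pderiv_at \<alpha> f"])
          (use pd in \<open>simp_all add: f smooth_on_pderiv_at Inl pderiv_at_def\<close>)
    next
      case (Inr \<alpha>)
      show ?thesis
        by (rule p_hom_zero) (use pd in \<open>simp add: Inr lin0 f\<close>)
    qed
    then show ?thesis
      using gD by (auto simp: differentiable_def)
  next
    case 3
    then have "(g has_derivative (\<lambda>v. 0)) (at x)" if "q_of x \<in> V" for x
      using g that by (intro tr[of "\<lambda>_. 0"]) (auto simp: p_hom_ge_2)
    then show ?thesis
      by (auto simp: differentiable_def intro!: p_hom_zero pderiv_at_eq)
  qed
  then show "q_of x \<in> V \<Longrightarrow> g differentiable (at x)"
    and "p_hom V (w + p_weight j) (pderiv_at j g)" by auto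
qed

section \<open>The Moyal product on the fibre\<close>

lemma sum_UNIV_sum_type:
  "(\<Sum>k\<in>UNIV. f k) = (\<Sum>\<alpha>\<in>UNIV. f (Inl \<alpha>)) + (\<Sum>\<alpha>\<in>UNIV. f (Inr \<alpha>))"
  for f :: "'a::finite + 'b::finite \<Rightarrow> _"
  by (simp add: sum.Plus flip: UNIV_Plus_UNIV)

text \<open>\<open>omega\<close> squares to minus the identity, so its negative is a two-sided
  inverse. \<open>matrix_inv\<close> chooses some two-sided inverse, and inverses are
  unique.\<close>

lemma omega_inv_eq: "omega_inv = - (omega :: real^('n::finite + 'n)^('n + 'n))"
proof -
  have "(\<Sum>k\<in>UNIV. omega $ i $ k * omega $ k $ j) = - (mat 1 :: real^('n + 'n)^('n + 'n)) $ i $ j"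
    for i j
    by (cases i; cases j)
      (simp_all add: omega_def mat_def sum_UNIV_sum_type if_distrib[of "\<lambda>t. t * _"] cong: if_cong)
  then have sq: "omega ** omega = - (mat 1 :: real^('n + 'n)^('n + 'n))"
    by (simp add: vec_eq_iff matrix_matrix_mult_def)
  have 1: "omega ** (- omega) = (mat 1 :: real^('n + 'n)^('n + 'n))"
    "(- omega) ** omega = (mat 1 :: real^('n + 'n)^('n + 'n))"
    using sq by (auto simp: vec_eq_iff matrix_matrix_mult_def sum_negf)
  have "omega ** omega_inv = (mat 1 :: real^('n + 'n)^('n + 'n))"
    unfolding omega_inv_def using 1 unfolding matrix_inv_def by - (rule someI2, auto)
  then show ?thesis
    using 1 by (metis matrix_mul_assoc matrix_mul_lid matrix_mul_rid)
qed

lemma omega_antisym: "omega $ j $ i = - (omega $ i $ j)"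
  by (auto simp: omega_def split: sum.split)

text \<open>Only a position index and a momentum index are paired. Hence each contraction removes
  exactly one unit of weight from the two factors together.\<close>

lemma omega_nonzero_weight: "omega $ i $ j \<noteq> 0 \<Longrightarrow> p_weight i + p_weight j = 1"
  by (auto simp: omega_def split: sum.splits)

lemma prod_omega_inv_swap:
  "length is = t \<Longrightarrow> length js = t \<Longrightarrow>
    (\<Prod>s<t. omega_inv $ (js ! s) $ (is ! s)) = (- 1) ^ t * (\<Prod>s<t. omega_inv $ (is ! s) $ (js ! s))"
  using omega_antisym[of "js ! _" "is ! _"] by (simp add: omega_inv_eq prod_uminus)

lemma prod_omega_inv_weight:
  assumes "length is = t" "length js = t" "(\<Prod>s<t. omega_inv $ (is ! s) $ (js ! s)) \<noteq> 0"
  shows "mset_weight (mset is) + mset_weight (mset js) = t"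
  using assms
proof (induction t arbitrary: "is" js)
  case (Suc t)
  then obtain i is' j js' where [simp]: "is = i # is'" "js = j # js'"
    by (metis length_Suc_conv)
  show ?case
    using Suc.prems Suc.IH[of is' js'] omega_nonzero_weight[of i j]
    by (simp add: prod.lessThan_Suc_shift omega_inv_eq del: prod.lessThan_Suc)
qed simp

text \<open>The combinatorial factor produced by iterating \<open>y_deriv\<close>: every index put
  back raises the count seen by the later ones. It enters the weight argument as a real
  scalar.\<close>

fun deriv_coeff :: "'i list \<Rightarrow> 'i multiset \<Rightarrow> nat" where
  "deriv_coeff [] M = 1"
| "deriv_coeff (i # is) M = (count M i + 1) * deriv_coeff is (add_mset i M)"

lemma foldr_y_deriv: "foldr y_deriv is a h M = of_nat (deriv_coeff is M) * a h (M + mset is)"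
  by (induction "is" arbitrary: M) (simp_all add: y_deriv_def algebra_simps)

text \<open>The part of the product with exactly \<open>t\<close> contractions, stripped of its
  numerical prefactor and of \<open>\<hbar>^t\<close>; the argument \<open>h\<close> thus counts
  only powers of \<hbar> coming from the factors.\<close>

definition circ_term ::
  "nat \<Rightarrow> ('n::finite + 'n) weyl \<Rightarrow> ('n + 'n) weyl \<Rightarrow> ('n + 'n) weyl" where
  "circ_term t a b = (\<lambda>h M. \<Sum>is | length is = t. \<Sum>js | length js = t.
     of_real (\<Prod>s<t. omega_inv $ (is ! s) $ (js ! s)) *
     series_mult (foldr y_deriv is a) (foldr y_deriv js b) h M)"

lemma weyl_circ_circ_term:
  "weyl_circ a b h M = (\<Sum>t\<le>h. 1 / fact t * (- \<i> / 2) ^ t * circ_term t a b (h - t) M)"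
  by (simp add: weyl_circ_def circ_term_def)

lemma weyl_circ_add_left: "weyl_circ (a + a') b = weyl_circ a b + weyl_circ a' b"
  and weyl_circ_add_right: "weyl_circ a (b + b') = weyl_circ a b + weyl_circ a b'"
  by (intro ext, simp add: weyl_circ_def series_mult_def foldr_y_deriv distrib_left distrib_right
      sum.distrib)+

text \<open>Exchanging the two index lists transposes every entry of \<open>omega_inv\<close>, and
  antisymmetry gives one sign per contraction. Even contractions therefore cancel in
  commutators.\<close>

lemma circ_term_swap: "circ_term t b a 0 M = (- 1) ^ t * circ_term t a b 0 M"
proof -
  have "circ_term t b a 0 M = (\<Sum>js | length js = t. \<Sum>is | length is = t.
     of_real (\<Prod>s<t. omega_inv $ (is ! s) $ (js ! s)) *
     series_mult (foldr y_deriv is b) (foldr y_deriv js a) 0 M)"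
    unfolding circ_term_def by (rule sum.swap)
  also have "\<dots> = (- 1) ^ t * circ_term t a b 0 M"
    unfolding circ_term_def sum_distrib_left
  proof (intro sum.cong refl)
    fix "is" js :: "('a + 'a) list"
    assume "is \<in> {is. length is = t}" "js \<in> {is. length is = t}"
    then show "of_real (\<Prod>s<t. omega_inv $ (js ! s) $ (is ! s)) *
        series_mult (foldr y_deriv js b) (foldr y_deriv is a) 0 M =
        (- 1) ^ t * (of_real (\<Prod>s<t. omega_inv $ (is ! s) $ (js ! s)) *
        series_mult (foldr y_deriv is a) (foldr y_deriv js b) 0 M)"
      by (simp only: prod_omega_inv_swap[of "is" t js] mem_Collect_eq
          series_mult_commute[of "foldr y_deriv js b"]) simp
  qed
  finally show ?thesis .
qed

text \<open>A summand with nonzero \<open>omega_inv\<close> product differentiates by indices of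
  total weight \<open>t\<close>, so vanishing has to be checked for such index lists only.\<close>

lemma circ_term_eq_0:
  assumes "\<And>is js k N. length is = t \<Longrightarrow> length js = t \<Longrightarrow>
      mset_weight (mset is) + mset_weight (mset js) = t \<Longrightarrow> k \<le> h \<Longrightarrow> N \<subseteq># M \<Longrightarrow>
      a k (N + mset is) * b (h - k) (M - N + mset js) = 0"
  shows "circ_term t a b h M = 0"
proof -
  have "of_real (\<Prod>s<t. omega_inv $ (is ! s) $ (js ! s)) *
      series_mult (foldr y_deriv is a) (foldr y_deriv js b) h M = 0"
    if l: "length is = t" "length js = t" for "is" js
  proof (cases "(\<Prod>s<t. omega_inv $ (is ! s) $ (js ! s)) = 0")
    case False
    then have "foldr y_deriv is a k N * foldr y_deriv js b (h - k) (M - N) = 0"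
      if "k \<le> h" "N \<subseteq># M" for k N
      using assms[OF l prod_omega_inv_weight[OF l False] that] by (auto simp only: foldr_y_deriv mult_eq_0_iff)
    then have "series_mult (foldr y_deriv is a) (foldr y_deriv js b) h M = 0"
      unfolding series_mult_def by (intro sum.neutral ballI) auto
    then show ?thesis
      by simp
  qed simp
  then show ?thesis
    unfolding circ_term_def by (intro sum.neutral ballI) auto
qed

text \<open>In degree \<open>z\<close>, the factors have degrees adding up to \<open>z + 2\<close>. As both start in degree \<open>2\<close>,
  only their parts of degree at most \<open>z\<close> matter.\<close>

lemma weyl_commutator_no_hbar:
  assumes low: "\<And>h M. 2 * h + size M < 2 \<Longrightarrow> a h M = 0" "\<And>h M. 2 * h + size M < 2 \<Longrightarrow> b h M = 0"
    and hbar: "\<And>h M. 0 < h \<Longrightarrow> 2 * h + size M \<le> z \<Longrightarrow> a h M = 0"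
      "\<And>h M. 0 < h \<Longrightarrow> 2 * h + size M \<le> z \<Longrightarrow> b h M = 0"
    and z: "2 * h + size M = z"
  shows "weyl_circ a b (Suc h) M - weyl_circ b a (Suc h) M =
    1 / fact (Suc h) * (- \<i> / 2) ^ Suc h * (1 - (- 1) ^ Suc h) * circ_term (Suc h) a b 0 M"
proof -
  \<comment> \<open>Proved for arbitrary factors, so that it applies to both orders of the
    product.\<close>
  have *: "weyl_circ a b (Suc h) M = 1 / fact (Suc h) * (- \<i> / 2) ^ Suc h * circ_term (Suc h) a b 0 M"
    if low: "\<And>h M. 2 * h + size M < 2 \<Longrightarrow> a h M = 0" "\<And>h M. 2 * h + size M < 2 \<Longrightarrow> b h M = 0"
      and hbar: "\<And>h M. 0 < h \<Longrightarrow> 2 * h + size M \<le> z \<Longrightarrow> a h M = 0"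
        "\<And>h M. 0 < h \<Longrightarrow> 2 * h + size M \<le> z \<Longrightarrow> b h M = 0"
    for a b :: "('a + 'a) weyl"
  proof -
    \<comment> \<open>With at most \<open>h\<close> contractions some factor must supply a positive
      power of \<hbar>; hence only \<open>t = Suc h\<close> remains.\<close>
    have "circ_term t a b (Suc h - t) M = 0" if t: "t \<le> h" for t
    proof (rule circ_term_eq_0)
      fix "is" js :: "('a + 'a) list" and k N
      assume l: "length is = t" "length js = t" and k: "k \<le> Suc h - t" and N: "N \<subseteq># M"
      define d e where "d = 2 * k + size (N + mset is)"
        and "e = 2 * (Suc h - t - k) + size (M - N + mset js)"
      have "size N \<le> size M"
        using N by (rule size_mset_mono)
      then have "d + e = z + 2"
        using l k t z unfolding d_def e_def size_union size_Diff_submset[OF N] by simp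
      then consider "d < 2" | "e < 2" | "d \<le> z" "e \<le> z"
        by linarith
      then show "a k (N + mset is) * b (Suc h - t - k) (M - N + mset js) = 0"
      proof cases
        case 3
        have "0 < k \<or> 0 < Suc h - t - k"
          using t by linarith
        then show ?thesis
          using 3 hbar(1)[of k "N + mset is"] hbar(2)[of "Suc h - t - k" "M - N + mset js"]
          unfolding d_def e_def by auto
      qed (use low(1)[of k "N + mset is"] low(2)[of "Suc h - t - k" "M - N + mset js"]
          in \<open>auto simp: d_def e_def\<close>)
    qed
    then show ?thesis
      unfolding weyl_circ_circ_term by simp
  qed
  have ab: "weyl_circ a b (Suc h) M =
      1 / fact (Suc h) * (- \<i> / 2) ^ Suc h * circ_term (Suc h) a b 0 M"
    using low hbar by (rule *)
  have ba: "weyl_circ b a (Suc h) M =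
      1 / fact (Suc h) * (- \<i> / 2) ^ Suc h * circ_term (Suc h) b a 0 M"
    using low(2,1) hbar(2,1) by (rule *)
  show ?thesis
    unfolding ab ba circ_term_swap[of "Suc h" b a] by (simp only: algebra_simps mult_1)
qed

section \<open>The recursion for the Abelian connection series\<close>

text \<open>By bilinearity the quadratic parts in \<open>g\<close> and \<open>r\<close> merge into
  one commutator of components of \<open>g + r\<close>. The division by \<hbar> is the reason for
  \<open>Suc h\<close>.\<close>

lemma abelian_curv_eq:
  "abelian_curv g r x j k h M = wd g x j k h M + wd r x j k h M +
    \<i> * (weyl_circ (g x j + r x j) (g x k + r x k) (Suc h) M -
         weyl_circ (g x k + r x k) (g x j + r x j) (Suc h) M)"
  by (simp add: abelian_curv_def w_curv_def w_partial_def w_i_over_hbar_def i_over_hbar_def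
      wcomm_def wcirc_def weyl_scale_def weyl_circ_add_left weyl_circ_add_right algebra_simps)

lemma p_hom_wd:
  assumes "open V" "p_hom V (p_weight k + w) (\<lambda>x. a x k h M)"
    and "p_hom V (p_weight j + w) (\<lambda>x. a x j h M)"
  shows "p_hom V (p_weight j + p_weight k + w) (\<lambda>x. wd a x j k h M)"
  unfolding wd_def
  using p_hom_derivative(2)[OF assms(1,2), of j] p_hom_derivative(2)[OF assms(1,3), of k]
  by (intro p_hom_diff assms(1)) (simp_all add: ac_simps)

text \<open>The number of contractions is \<open>h + 1\<close>. One contraction leaves the weight right, two cancel
  in the commutator, and three exceed the total weight of the factors. Giving \<open>\<hbar>\<close> the weight
  \<open>2\<close> forces the coefficients of its positive powers to vanish.\<close>

lemma p_hom_commutator: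
  fixes a :: "('n::finite + 'n) wform1"
  assumes V: "open V"
    and low: "\<And>x k h M. q_of x \<in> V \<Longrightarrow> 2 * h + size M < 2 \<Longrightarrow> a x k h M = 0"
    and hom: "\<And>k h M. 2 * h + size M \<le> z \<Longrightarrow>
      p_hom V (p_weight k + mset_weight M + 2 * h) (\<lambda>x. a x k h M)"
    and z: "2 * h + size M = z"
  shows "p_hom V (p_weight j + p_weight k + mset_weight M + 2 * h)
    (\<lambda>x. \<i> * (weyl_circ (a x j) (a x k) (Suc h) M - weyl_circ (a x k) (a x j) (Suc h) M))"
proof -
  have hbar: "a x k h M = 0" if "q_of x \<in> V" "0 < h" "2 * h + size M \<le> z" for x k h M
    using hom[of h M k] that by (simp add: p_hom_ge_2)
  have heavy: "a x k h M = 0"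
    if "q_of x \<in> V" "2 \<le> p_weight k + mset_weight M" "2 * h + size M \<le> z" for x k h M
    using hom[of h M k] that by (simp add: p_hom_ge_2)
  have comm: "weyl_circ (a x j) (a x k) (Suc h) M - weyl_circ (a x k) (a x j) (Suc h) M =
      1 / fact (Suc h) * (- \<i> / 2) ^ Suc h * (1 - (- 1) ^ Suc h) *
        circ_term (Suc h) (a x j) (a x k) 0 M" if "q_of x \<in> V" for x
    by (rule weyl_commutator_no_hbar[where z = z]) (use that low hbar z in blast)+
  consider "h = 0" | "h = 1" | "2 \<le> h" by linarith
  then show ?thesis
  proof cases
    case 1
    have "p_hom V (p_weight j + p_weight k + mset_weight M)
        (\<lambda>x. circ_term 1 (a x j) (a x k) 0 M)"
      unfolding circ_term_def
    proof (intro p_hom_sum V)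
      fix "is" js :: "('n + 'n) list"
      assume "is \<in> {is. length is = 1}" "js \<in> {js. length js = 1}"
      then have l: "length is = 1" "length js = 1" by simp_all
      show "p_hom V (p_weight j + p_weight k + mset_weight M)
        (\<lambda>x. of_real (\<Prod>s<1. omega_inv $ (is ! s) $ (js ! s)) *
          series_mult (foldr y_deriv is (a x j)) (foldr y_deriv js (a x k)) 0 M)"
      proof (cases "(\<Prod>s<1. omega_inv $ (is ! s) $ (js ! s)) = 0")
        case False
        show ?thesis
          unfolding series_mult_def
        proof (intro p_hom_scale p_hom_sum V)
          fix m N
          assume "m \<in> {..0::nat}" "N \<in> {N. N \<subseteq># M}"
          then have m: "m = 0" and N: "N \<subseteq># M" by simp_all
          then have M: "M = N + (M - N)" by simp
          have "size N \<le> size M"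
            using N by (rule size_mset_mono)
          then have "size (N + mset is) + size (M - N + mset js) = z + 2"
            using l z 1 unfolding size_union size_Diff_submset[OF N] by simp
          then consider "size (N + mset is) < 2" | "size (M - N + mset js) < 2"
            | "size (N + mset is) \<le> z" "size (M - N + mset js) \<le> z"
            by linarith
          then show "p_hom V (p_weight j + p_weight k + mset_weight M)
            (\<lambda>x. foldr y_deriv is (a x j) m N * foldr y_deriv js (a x k) (0 - m) (M - N))"
          proof cases
            case 3
            have "mset_weight M = mset_weight N + mset_weight (M - N)"
              using M by (metis mset_weight_simps(3))
            \<comment> \<open>The two indices of the contraction have total weight one, which is the
              \<open>Suc\<close> required by \<open>p_hom_mult\<close>.\<close>
            then have "p_weight j + mset_weight (N + mset is) +
                (p_weight k + mset_weight (M - N + mset js)) =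
                Suc (p_weight j + p_weight k + mset_weight M)"
              using prod_omega_inv_weight[OF l False] by simp
            moreover have "p_hom V (p_weight j + mset_weight (N + mset is))
                (\<lambda>x. of_nat (deriv_coeff is N) * a x j 0 (N + mset is))"
              using p_hom_scale[OF V hom[of 0 "N + mset is" j], of "of_nat (deriv_coeff is N)"] 3
              by simp
            moreover have "p_hom V (p_weight k + mset_weight (M - N + mset js))
                (\<lambda>x. of_nat (deriv_coeff js (M - N)) * a x k 0 (M - N + mset js))"
              using p_hom_scale[OF V hom[of 0 "M - N + mset js" k],
                  of "of_nat (deriv_coeff js (M - N))"] 3
              by simp
            ultimately show ?thesis
              unfolding foldr_y_deriv m diff_0_eq_0 by (rule p_hom_mult[OF V, rotated -1])
          next
            case 1
            then show ?thesis
              using m by (intro p_hom_zero) (simp add: foldr_y_deriv low)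
          next
            case 2
            then show ?thesis
              using m by (intro p_hom_zero) (simp add: foldr_y_deriv low del: diff_union_single_conv)
          qed
        qed
      qed (simp add: p_hom_zero)
    qed
    then have "p_hom V (p_weight j + p_weight k + mset_weight M)
        (\<lambda>x. \<i> * (weyl_circ (a x j) (a x k) (Suc h) M - weyl_circ (a x k) (a x j) (Suc h) M))"
      by (rule p_hom_cong) (use comm in \<open>simp add: 1\<close>)
    then show ?thesis
      using 1 by simp
  next
    case 2
    then show ?thesis
      by (intro p_hom_zero) (use comm in \<open>simp add: 2\<close>)
  next
    case 3
    have "circ_term (Suc h) (a x j) (a x k) 0 M = 0" if x: "q_of x \<in> V" for x
    proof (rule circ_term_eq_0)
      fix "is" js :: "('n + 'n) list" and m N
      assume l: "length is = Suc h" "length js = Suc h" and m: "m \<le> (0::nat)" and N: "N \<subseteq># M"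
        and w: "mset_weight (mset is) + mset_weight (mset js) = Suc h"
      define d e where "d = size (N + mset is)" and "e = size (M - N + mset js)"
      have "size N \<le> size M"
        using N by (rule size_mset_mono)
      then have "d + e = z + 2"
        using l z unfolding d_def e_def size_union size_Diff_submset[OF N] by simp
      then consider "d < 2" | "e < 2" | "d \<le> z" "e \<le> z"
        by linarith
      then have "a x j 0 (N + mset is) = 0 \<or> a x k 0 (M - N + mset js) = 0"
      proof cases
        case 3
        \<comment> \<open>The contracted indices alone carry at least three units of weight, so one
          of the two factors carries at least two.\<close>
        have "2 \<le> p_weight j + mset_weight (N + mset is) \<or>
            2 \<le> p_weight k + mset_weight (M - N + mset js)"
          using w \<open>2 \<le> h\<close> unfolding mset_weight_simps by linarith
        then show ?thesis
          using heavy[OF x, of j "N + mset is" 0] heavy[OF x, of k "M - N + mset js" 0] 3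
          unfolding d_def e_def by auto
      qed (use low[OF x, of 0 "N + mset is" j] low[OF x, of 0 "M - N + mset js" k]
          in \<open>auto simp: d_def e_def\<close>)
      then show "a x j m (N + mset is) * a x k (0 - m) (M - N + mset js) = 0"
        using m by auto
    qed
    then show ?thesis
      by (intro p_hom_zero) (simp add: comm)
  qed
qed

lemma sum_fun_apply: "(\<Sum>i\<in>I. f i) x = (\<Sum>i\<in>I. f i x)"
  by (induction I rule: infinite_finite_induct) simp_all

text \<open>The identity \<open>a = \<delta>\<^sup>-\<^sup>1 \<delta> a\<close> for \<open>\<delta>\<^sup>-\<^sup>1 a = 0\<close>, read off at one monomial.\<close>

lemma wdelta_inv_wdelta:
  fixes a :: "'i::finite wform1"
  assumes "wdelta_inv a x = 0"
  shows "of_nat (size M + 1) * a x k h M = (\<Sum>j\<in>set_mset M. wdelta a x j k h (M - {#j#}))"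
proof -
  \<comment> \<open>The condition \<open>wdelta_inv a x = 0\<close> is read at the monomial to which
    the component \<open>a x k h M\<close> contributes.\<close>
  let ?M = "add_mset k M"
  have "wdelta_inv a x h ?M = (\<Sum>j\<in>set_mset ?M. a x j h (?M - {#j#}) / of_nat (Suc (size M)))"
    unfolding wdelta_inv_def sum_fun_apply y_mult_def
    by (intro sum.mono_neutral_cong_right) (auto simp: size_Diff_singleton)
  then have "(\<Sum>j\<in>set_mset ?M. a x j h (?M - {#j#})) = 0"
    using assms by (simp del: set_mset_add_mset_insert of_nat_Suc flip: sum_divide_distrib)
  then have 0: "(\<Sum>j\<in>set_mset M - {k}. a x j h (?M - {#j#})) = - a x k h M"
    by (subst (asm) set_mset_add_mset_insert, subst (asm) sum.insert_remove)
      (auto simp: eq_neg_iff_add_eq_0 add.commute)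
  \<comment> \<open>Removing \<open>j\<close> and then differentiating by \<open>k\<close> gives the
    factor \<open>count M k + 1\<close>, except that for \<open>j = k\<close> the removal cancels
    the increment.\<close>
  have 1: "wdelta a x j k h (M - {#j#}) = of_nat (count M j) * a x k h M -
      of_nat (count M k + (if j = k then 0 else 1)) * a x j h (?M - {#j#})" if "j \<in># M" for j
    using that by (auto simp: wdelta_def y_deriv_def)
  \<comment> \<open>The summand with \<open>j = k\<close> is split off. Fact \<open>0\<close>
    evaluates the rest, and together they leave a single \<open>- a x k h M\<close>, the source of
    the \<open>+ 1\<close> in the final factor.\<close>
  have "(\<Sum>j\<in>set_mset M. of_nat (count M k + (if j = k then 0 else 1)) * a x j h (?M - {#j#})) =
      (\<Sum>j\<in>set_mset M - {k}. of_nat (count M k + 1) * a x j h (?M - {#j#})) +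
      of_nat (count M k) * a x k h M"
  proof (cases "k \<in># M")
    case True
    then show ?thesis by (simp add: sum.remove[of _ k] add.commute)
  next
    case False
    then have "count M k = 0" "set_mset M - {k} = set_mset M"
      by (auto simp: not_in_iff)
    then show ?thesis using False by (auto intro!: sum.cong)
  qed
  also have "\<dots> = - a x k h M"
    unfolding sum_distrib_left[symmetric] 0 by (simp add: algebra_simps)
  finally have 2: "(\<Sum>j\<in>set_mset M. of_nat (count M k + (if j = k then 0 else 1)) *
      a x j h (?M - {#j#})) = - a x k h M" .
  have "(\<Sum>j\<in>set_mset M. wdelta a x j k h (M - {#j#})) =
      of_nat (\<Sum>j\<in>set_mset M. count M j) * a x k h M + a x k h M"
    using 2 by (simp add: 1 sum_subtractf sum_distrib_right)
  then show ?thesis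
    by (simp add: size_multiset_overloaded_eq algebra_simps)
qed

text \<open>The curvature in degree \<open>z\<close> needs \<open>r\<close> only up to degree
  \<open>z\<close>, while \<open>wdelta_inv\<close> raises the degree by one. This makes the
  recursion for \<open>r\<close> well founded.\<close>

lemma p_hom_abelian_curv:
  assumes V: "open V"
    and g_low: "\<And>x k h M. q_of x \<in> V \<Longrightarrow> 2 * h + size M < 2 \<Longrightarrow> g x k h M = 0"
    and r_low: "\<And>x k h M. q_of x \<in> V \<Longrightarrow> 2 * h + size M < 3 \<Longrightarrow> r x k h M = 0"
    and g: "\<And>k h M. p_hom V (p_weight k + mset_weight M + 2 * h) (\<lambda>x. g x k h M)"
    and r: "\<And>k h M. 2 * h + size M \<le> z \<Longrightarrow>
      p_hom V (p_weight k + mset_weight M + 2 * h) (\<lambda>x. r x k h M)"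
    and z: "2 * h + size M = z"
  shows "p_hom V (p_weight j + p_weight k + mset_weight M + 2 * h)
    (\<lambda>x. abelian_curv g r x j k h M)"
proof -
  have wd: "p_hom V (p_weight j + p_weight k + mset_weight M + 2 * h) (\<lambda>x. wd a x j k h M)"
    if "\<And>k. p_hom V (p_weight k + mset_weight M + 2 * h) (\<lambda>x. a x k h M)" for a
    using p_hom_wd[OF V, of k "mset_weight M + 2 * h" a h M j] that by (simp add: add.assoc)
  have "p_hom V (p_weight k + mset_weight M + 2 * h) (\<lambda>x. (g x k + r x k) h M)"
    if "2 * h + size M \<le> z" for k h M
    using p_hom_add[OF V g r[OF that]] by simp
  then have "p_hom V (p_weight j + p_weight k + mset_weight M + 2 * h)
      (\<lambda>x. \<i> * (weyl_circ (g x j + r x j) (g x k + r x k) (Suc h) M -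
         weyl_circ (g x k + r x k) (g x j + r x j) (Suc h) M))"
    using g_low r_low z by (intro p_hom_commutator[OF V, of "\<lambda>x k. g x k + r x k"]) auto
  then show ?thesis
    unfolding abelian_curv_eq using g r z by (intro p_hom_add[OF V] wd) auto
qed

text \<open>Induction on the degree: \<open>wdelta_inv_wdelta\<close> expresses a coefficient of
  \<open>r\<close> through curvature coefficients at monomials with one index removed, where only
  coefficients of \<open>r\<close> of smaller degree enter.\<close>

lemma p_hom_abelian_series:
  fixes g r :: "('n::finite + 'n) wform1"
  assumes V: "open V"
    and g_low: "\<And>x k h M. q_of x \<in> V \<Longrightarrow> 2 * h + size M < 2 \<Longrightarrow> g x k h M = 0"
    and r_low: "\<And>x k h M. q_of x \<in> V \<Longrightarrow> 2 * h + size M < 3 \<Longrightarrow> r x k h M = 0"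
    and g: "\<And>k h M. p_hom V (p_weight k + mset_weight M + 2 * h) (\<lambda>x. g x k h M)"
    and eq: "\<And>x. q_of x \<in> V \<Longrightarrow> wdelta r x = abelian_curv g r x"
    and inv: "\<And>x. q_of x \<in> V \<Longrightarrow> wdelta_inv r x = 0"
  shows "p_hom V (p_weight k + mset_weight M + 2 * h) (\<lambda>x. r x k h M)"
proof (induction "2 * h + size M" arbitrary: k h M rule: less_induct)
  case less
  show ?case
  proof (cases "M = {#}")
    case True
    \<comment> \<open>There is no index to remove, so the sum in \<open>wdelta_inv_wdelta\<close> is
      empty.\<close>
    have "r x k h M = 0" if "q_of x \<in> V" for x
      using wdelta_inv_wdelta[OF inv[OF that], of M k h] True by simp
    then show ?thesis
      by (rule p_hom_zero)
  next
    case False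
    \<comment> \<open>The division by \<open>size M + 1\<close> is written as a real scalar to fit
      \<open>p_hom_scale\<close>.\<close>
    have *: "r x k h M = of_real (inverse (real (Suc (size M)))) *
        (\<Sum>j\<in>set_mset M. abelian_curv g r x j k h (M - {#j#}))" if "q_of x \<in> V" for x
    proof -
      have "of_nat (Suc (size M)) * r x k h M =
          (\<Sum>j\<in>set_mset M. abelian_curv g r x j k h (M - {#j#}))"
        using wdelta_inv_wdelta[OF inv[OF that], of M k h] eq[OF that] by simp
      moreover have "r x k h M =
          of_real (inverse (real (Suc (size M)))) * (of_nat (Suc (size M)) * r x k h M)"
        unfolding mult.assoc[symmetric] of_real_inverse of_real_of_nat_eq
        by (subst left_inverse) (simp_all only: of_nat_neq_0 mult_1 not_False_eq_True)
      ultimately show ?thesis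
        by (simp only:)
    qed
    have "p_hom V (p_weight k + mset_weight M + 2 * h)
        (\<lambda>x. abelian_curv g r x j k h (M - {#j#}))" if j: "j \<in># M" for j
    proof -
      obtain N where N: "M = add_mset j N"
        using j by (metis insert_DiffM)
      \<comment> \<open>The index \<open>j\<close> is a differential in the curvature and a variable
        \<open>y\<close> in \<open>r\<close>; both carry the same weight.\<close>
      have "p_hom V (p_weight j + p_weight k + mset_weight N + 2 * h)
          (\<lambda>x. abelian_curv g r x j k h N)"
        by (rule p_hom_abelian_curv[OF V g_low r_low g less refl]) (simp_all add: N)
      then show ?thesis
        by (simp add: N ac_simps)
    qed
    then have "p_hom V (p_weight k + mset_weight M + 2 * h)
        (\<lambda>x. \<Sum>j\<in>set_mset M. abelian_curv g r x j k h (M - {#j#}))"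
      by (rule p_hom_sum[OF V])
    then have "p_hom V (p_weight k + mset_weight M + 2 * h)
        (\<lambda>x. of_real (inverse (real (Suc (size M)))) *
          (\<Sum>j\<in>set_mset M. abelian_curv g r x j k h (M - {#j#})))"
      by (rule p_hom_scale[OF V])
    then show ?thesis
      by (rule p_hom_cong) (rule *)
  qed
qed

section \<open>Darboux charts and compatible connections\<close>

lemma smooth_manifoldD:
  assumes "smooth_manifold X A"
  shows "c \<in> A \<Longrightarrow> is_chart X c"
    and "c \<in> A \<Longrightarrow> c' \<in> A \<Longrightarrow> smoothly_compatible c c'"
proof -
  have "\<forall>c\<in>A. is_chart X c"
    using assms unfolding smooth_manifold_def by (elim conjE)
  moreover have "\<forall>c\<in>A. \<forall>c'\<in>A. smoothly_compatible c c'"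
    using assms unfolding smooth_manifold_def by (elim conjE)
  ultimately show "c \<in> A \<Longrightarrow> is_chart X c" and "c \<in> A \<Longrightarrow> c' \<in> A \<Longrightarrow> smoothly_compatible c c'"
    by blast+
qed

lemma is_chart_inj_on: "is_chart X c \<Longrightarrow> inj_on (coords c) (chart_dom c)"
  unfolding is_chart_def homeomorphic_map_def
  by (auto dest!: openin_subset homeomorphic_imp_injective_map simp: inf_absorb2)

lemma is_chart_open_image:
  assumes "is_chart X c" "openin X U" "U \<subseteq> chart_dom c"
  shows "open (coords c ` U)"
proof -
  have "open_map (subtopology X (chart_dom c)) (top_of_set (chart_img c)) (coords c)"
    using assms(1) unfolding is_chart_def by (auto intro: homeomorphic_imp_open_map)
  moreover have "openin (subtopology X (chart_dom c)) U"
    using assms unfolding is_chart_def by (simp add: openin_open_subtopology)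
  ultimately have "openin (top_of_set (chart_img c)) (coords c ` U)"
    unfolding open_map_def by blast
  then show ?thesis
    using assms(1) unfolding is_chart_def by (metis openin_open_eq)
qed

lemma transition_coords:
  "inj_on (coords c) (chart_dom c) \<Longrightarrow> w \<in> chart_dom c \<Longrightarrow> transition c c' (coords c w) = coords c' w"
  by (simp add: transition_def)

lemma jacobian_eq:
  assumes "(transition c c' has_derivative D) (at x)"
  shows "jacobian c c' x a b = D (axis b 1) $ a"
  unfolding jacobian_def
  by (rule pderiv_at_eq) (rule bounded_linear.has_derivative[OF bounded_linear_vec_nth assms])

lemma jacobian_self:
  assumes "is_chart X c" "w \<in> chart_dom c"
  shows "jacobian c c (coords c w) a b = of_bool (a = b)"
proof -
  have 1: "open (chart_img c)"
    using assms by (simp add: is_chart_def)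
  have 2: "id y = transition c c y" if "y \<in> chart_img c" for y
    using that transition_coords[OF is_chart_inj_on[OF assms(1)], of _ c]
    unfolding chart_img_def image_iff by (metis id_apply)
  have 3: "coords c w \<in> chart_img c"
    using assms(2) by (simp add: chart_img_def)
  have "(transition c c has_derivative id) (at (coords c w))"
    by (rule has_derivative_transform_within_open[OF has_derivative_id 1 3 2])
  then show ?thesis
    by (subst jacobian_eq) (auto simp: axis_def)
qed

text \<open>The chain rule on the open image of the overlap, where the transition maps compose. It
  makes a covector prescribed in one chart consistent in all others.\<close>

lemma jacobian_cocycle:
  assumes A: "smooth_manifold X A" and c: "c \<in> A" "c' \<in> A" "c'' \<in> A"
    and w: "w \<in> chart_dom c" "w \<in> chart_dom c'" "w \<in> chart_dom c''"
  shows "jacobian c c'' (coords c w) \<mu> \<beta> =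
    (\<Sum>\<alpha>\<in>UNIV. jacobian c' c'' (coords c' w) \<mu> \<alpha> * jacobian c c' (coords c w) \<alpha> \<beta>)"
proof -
  note ch = smooth_manifoldD(1)[OF A]
  have diff: "\<exists>D. (transition d d' has_derivative D) (at (coords d w))"
    if "d \<in> A" "d' \<in> A" "w \<in> chart_dom d" "w \<in> chart_dom d'" for d d'
  proof -
    have "smooth_on (coords d ` (chart_dom d \<inter> chart_dom d')) (transition d d')"
      using smooth_manifoldD(2)[OF A that(1,2)] by (simp add: smoothly_compatible_def)
    then show ?thesis
      using that(3,4) smooth_on_imp_differentiable[of _ "transition d d'" "coords d w"]
      unfolding differentiable_def by blast
  qed
  obtain D where D: "(transition c c' has_derivative D) (at (coords c w))"
    using diff c w by blast
  obtain E where E: "(transition c' c'' has_derivative E) (at (coords c' w))"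
    using diff c w by blast
  let ?U = "chart_dom c \<inter> chart_dom c'"
  have "open (coords c ` ?U)"
    using ch[OF c(1)] ch[OF c(2)]
    by (intro is_chart_open_image[of X]) (auto simp: is_chart_def)
  moreover have tr: "transition c c' (coords c u) = coords c' u"
    "transition c' c'' (coords c' u) = coords c'' u" "transition c c'' (coords c u) = coords c'' u"
    if "u \<in> ?U" for u
    using that is_chart_inj_on[OF ch] c by (auto simp: transition_coords)
  moreover have "((\<lambda>u. transition c' c'' (transition c c' u)) has_derivative (\<lambda>v. E (D v)))
      (at (coords c w))"
    using D E tr(1)[of w] w by (intro has_derivative_compose[OF D]) simp
  ultimately have DE: "(transition c c'' has_derivative (\<lambda>v. E (D v))) (at (coords c w))"
    using w by (elim has_derivative_transform_within_open) auto
  have "E v $ \<mu> = (\<Sum>\<alpha>\<in>UNIV. E (axis \<alpha> 1) $ \<mu> * v $ \<alpha>)" for v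
  proof -
    have lin: "linear E"
      using E has_derivative_linear by blast
    have "E v = E (\<Sum>\<alpha>\<in>UNIV. v $ \<alpha> *\<^sub>R axis \<alpha> 1)"
      using basis_expansion[of v] by (simp add: scalar_mult_eq_scaleR)
    also have "\<dots> = (\<Sum>\<alpha>\<in>UNIV. v $ \<alpha> *\<^sub>R E (axis \<alpha> 1))"
      by (simp add: linear_sum[OF lin] linear_scale[OF lin])
    finally show ?thesis
      by (simp add: mult.commute)
  qed
  then show ?thesis
    unfolding jacobian_eq[OF D] jacobian_eq[OF E] jacobian_eq[OF DE] .
qed

text \<open>Components of a covector can be chosen freely in one chart, so the range of the
  coordinates is the full cylinder over the range of \<open>q\<close>. This is the domain on which
  \<open>p_hom\<close> is formulated.\<close>

lemma chart_img_darboux_chart: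
  assumes A: "smooth_manifold X A" and c: "c \<in> A"
  shows "chart_img (darboux_chart A c) = q_of -` chart_img c"
proof
  show "chart_img (darboux_chart A c) \<subseteq> q_of -` chart_img c"
    by (auto simp: chart_img_def darboux_chart_def q_of_def)
next
  show "q_of -` chart_img c \<subseteq> chart_img (darboux_chart A c)"
  proof
    fix x
    assume "x \<in> q_of -` chart_img c"
    then obtain w where w: "w \<in> chart_dom c" "q_of x = coords c w"
      by (auto simp: chart_img_def)
    \<comment> \<open>The covector with components \<open>p_of x\<close> in \<open>c\<close>,
      transported to every chart around \<open>w\<close>; the value \<open>0\<close> elsewhere is
      the normalisation in \<open>cotangent_space\<close>.\<close>
    define \<xi> where "\<xi> = (\<lambda>c'. if c' \<in> A \<and> w \<in> chart_dom c'
      then \<chi> \<beta>. \<Sum>\<mu>\<in>UNIV. p_of x $ \<mu> * jacobian c' c (coords c' w) \<mu> \<beta> else 0)"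
    have "\<xi> c2 $ \<beta> = (\<Sum>\<alpha>\<in>UNIV. \<xi> c1 $ \<alpha> * jacobian c2 c1 (coords c2 w) \<alpha> \<beta>)"
      if c12: "c1 \<in> A" "c2 \<in> A" "w \<in> chart_dom c1" "w \<in> chart_dom c2" for c1 c2 \<beta>
    proof -
      have "\<xi> c2 $ \<beta> = (\<Sum>\<mu>\<in>UNIV. \<Sum>\<alpha>\<in>UNIV. p_of x $ \<mu> * jacobian c1 c (coords c1 w) \<mu> \<alpha> *
          jacobian c2 c1 (coords c2 w) \<alpha> \<beta>)"
        using c12
        by (simp add: \<xi>_def jacobian_cocycle[OF A c12(2,1) c c12(4,3) w(1)] sum_distrib_left mult.assoc)
      also have "\<dots> = (\<Sum>\<alpha>\<in>UNIV. \<Sum>\<mu>\<in>UNIV. p_of x $ \<mu> * jacobian c1 c (coords c1 w) \<mu> \<alpha> *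
          jacobian c2 c1 (coords c2 w) \<alpha> \<beta>)"
        by (rule sum.swap)
      finally show ?thesis
        using c12 by (simp add: \<xi>_def sum_distrib_right)
    qed
    moreover have "\<xi> c1 = 0" if "\<not> (c1 \<in> A \<and> w \<in> chart_dom c1)" for c1
      using that by (simp only: \<xi>_def if_False)
    ultimately have \<xi>: "\<xi> \<in> cotangent_space A w"
      unfolding cotangent_space_def by blast
    have "\<xi> c = p_of x"
      using c w
      by (simp add: \<xi>_def vec_eq_iff jacobian_self[OF smooth_manifoldD(1)[OF A c]])
    then have "coords (darboux_chart A c) (w, \<xi>) = x"
      using w(2)[symmetric] by (simp add: darboux_chart_def vec_eq_iff q_of_def p_of_def split: sum.split)
    then show "x \<in> chart_img (darboux_chart A c)"
      unfolding chart_img_def using w \<xi> by (force simp: darboux_chart_def)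
  qed
qed

text \<open>Parallelism of \<open>\<omega>\<close> is the symmetry in the first two indices, since \<open>\<omega>\<close> is
  constant and antisymmetric.\<close>

lemma lowered_symmetric:
  assumes "symplectic_connection A \<gamma>" "d \<in> cot_atlas A" "x \<in> chart_img d"
  shows "lowered (\<gamma> d) x i j k = lowered (\<gamma> d) x i k j"
    and "lowered (\<gamma> d) x i j k = lowered (\<gamma> d) x j i k"
proof -
  show "lowered (\<gamma> d) x i j k = lowered (\<gamma> d) x i k j"
    using assms unfolding symplectic_connection_def torsion_free_def lowered_def by simp
  have "cov_deriv (\<gamma> d) (\<lambda>_ i j. omega $ i $ j) x k i j = 0"
    using assms unfolding symplectic_connection_def by blast
  then have "(\<Sum>l\<in>UNIV. \<gamma> d x l i k * omega $ l $ j) + (\<Sum>l\<in>UNIV. \<gamma> d x l j k * omega $ i $ l) = 0"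
    by (simp add: cov_deriv_def pderiv_at_def)
  then show "lowered (\<gamma> d) x i j k = lowered (\<gamma> d) x j i k"
    by (simp add: lowered_def omega_antisym[of _ j] sum_negf mult.commute)
qed

text \<open>Compatibility prescribes the components with momentum indices in front; total symmetry
  carries them to all other index positions. In terms of weight, the connection is homogeneous of
  weight one.\<close>

lemma p_hom_lowered:
  assumes A: "smooth_manifold X A" and \<Gamma>: "linear_connection A \<Gamma>"
    and \<gamma>: "symplectic_connection A \<gamma>" and comp: "compatible_connection A \<Gamma> \<gamma>" and c: "c \<in> A"
  defines "V \<equiv> chart_img c" and "g \<equiv> lowered (\<gamma> (darboux_chart A c))"
  shows "p_hom V (p_weight i + p_weight j + p_weight k) (\<lambda>x. of_real (g x i j k))"
proof -
  have V: "open V"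
    using smooth_manifoldD(1)[OF A c] by (simp add: V_def is_chart_def)
  have img: "chart_img (darboux_chart A c) = q_of -` V"
    unfolding V_def by (rule chart_img_darboux_chart[OF A c])
  have d: "darboux_chart A c \<in> cot_atlas A"
    using c by (simp add: cot_atlas_def)
  note comp' = bspec[OF comp[unfolded compatible_connection_def Let_def] c,
      folded g_def, unfolded img, folded V_def]
  note sym = lowered_symmetric[OF \<gamma> d, folded g_def, unfolded img vimage_eq]
  have IJK: "g x (Inr \<alpha>) (Inr \<beta>) (Inr \<delta>) = 0" "g x (Inr \<alpha>) (Inr \<beta>) (Inl \<delta>) = 0"
    "g x (Inr \<alpha>) (Inl \<beta>) (Inl \<delta>) = - \<Gamma> c (q_of x) \<alpha> \<beta> \<delta>" if "q_of x \<in> V" for x \<alpha> \<beta> \<delta>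
    using comp' that by simp_all
  obtain f where "\<forall>\<epsilon> \<alpha> \<beta> \<delta>. smooth_on V (f \<epsilon> \<alpha> \<beta> \<delta>)"
      "\<forall>x\<in>q_of -` V. \<forall>\<alpha> \<beta> \<delta>.
        g x (Inl \<alpha>) (Inl \<beta>) (Inl \<delta>) = (\<Sum>\<epsilon>\<in>UNIV. p_of x $ \<epsilon> * f \<epsilon> \<alpha> \<beta> \<delta> (q_of x))"
    using comp' by (elim conjE exE) (rule that)
  then have f: "smooth_on V (f \<epsilon> \<alpha> \<beta> \<delta>)"
      "q_of x \<in> V \<Longrightarrow>
        g x (Inl \<alpha>) (Inl \<beta>) (Inl \<delta>) = (\<Sum>\<epsilon>\<in>UNIV. p_of x $ \<epsilon> * f \<epsilon> \<alpha> \<beta> \<delta> (q_of x))"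
    for \<epsilon> \<alpha> \<beta> \<delta> x
    by simp_all
  have \<Gamma>_smooth: "smooth_on V (\<lambda>q. - \<Gamma> c q \<alpha> \<beta> \<delta>)" for \<alpha> \<beta> \<delta>
    using \<Gamma> c smooth_on_mult[OF V smooth_on_const, of "\<lambda>q. \<Gamma> c q \<alpha> \<beta> \<delta>" "- 1"]
    by (simp add: linear_connection_def V_def)
  have lin: "p_hom V 0 (\<lambda>x. of_real (g x (Inl \<alpha>) (Inl \<beta>) (Inl \<delta>)))" for \<alpha> \<beta> \<delta>
    by (rule p_hom_0I[of V "\<lambda>\<epsilon>. f \<epsilon> \<alpha> \<beta> \<delta>"]) (simp_all add: f mult.commute)
  have const: "p_hom V (Suc 0) (\<lambda>x. of_real (g x (Inr \<alpha>) (Inl \<beta>) (Inl \<delta>)))" for \<alpha> \<beta> \<delta>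
    by (rule p_hom_1I[OF \<Gamma>_smooth[of \<alpha> \<beta> \<delta>]]) (simp add: IJK)
  have const': "p_hom V (Suc 0) (\<lambda>x. of_real (g x (Inl \<beta>) (Inr \<alpha>) (Inl \<delta>)))" for \<alpha> \<beta> \<delta>
    using const[of \<alpha> \<beta> \<delta>] by (rule p_hom_cong) (simp add: sym(2)[of _ "Inl _"])
  have const'': "p_hom V (Suc 0) (\<lambda>x. of_real (g x (Inl \<beta>) (Inl \<delta>) (Inr \<alpha>)))" for \<alpha> \<beta> \<delta>
    using const'[of \<beta> \<alpha> \<delta>] by (rule p_hom_cong) (simp add: sym(1)[of _ _ "Inl _"])
  have zero: "g x (Inr \<alpha>) (Inl \<beta>) (Inr \<delta>) = 0" "g x (Inl \<beta>) (Inr \<alpha>) (Inr \<delta>) = 0"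
    if "q_of x \<in> V" for x \<alpha> \<beta> \<delta>
    using IJK(2)[OF that] sym[OF that] by metis+
  show ?thesis
    by (cases i; cases j; cases k)
      (auto simp: lin const const' const'' IJK zero intro: p_hom_zero)
qed

section \<open>Expansion into terms\<close>

lemma connection_form_apply:
  "connection_form G x k h M =
    (\<Sum>i\<in>UNIV. \<Sum>j\<in>UNIV. if h = 0 \<and> M = {#i, j#} then of_real (1 / 2 * lowered G x i j k) else 0)"
  unfolding connection_form_def sum_fun_apply weyl_scale_def y_monomial_def
  by (intro sum.cong refl) simp

lemma connection_form_low: "2 * h + size M < 2 \<Longrightarrow> connection_form G x k h M = 0"
  unfolding connection_form_apply by (intro sum.neutral ballI) auto

lemma p_hom_connection_form:
  assumes V: "open V"
    and G: "\<And>i j k. p_hom V (p_weight i + p_weight j + p_weight k) (\<lambda>x. of_real (lowered G x i j k))"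
  shows "p_hom V (p_weight k + mset_weight M + 2 * h) (\<lambda>x. connection_form G x k h M)"
  unfolding connection_form_apply
proof (intro p_hom_sum V)
  fix i j
  show "p_hom V (p_weight k + mset_weight M + 2 * h)
    (\<lambda>x. if h = 0 \<and> M = {#i, j#} then of_real (1 / 2 * lowered G x i j k) else 0)"
    using p_hom_scale[OF V G[of i j k], of "1 / 2"]
    by (cases "h = 0 \<and> M = {#i, j#}") (auto simp: ac_simps intro: p_hom_zero)
qed

text \<open>Serves 1-forms and 2-forms alike, with \<open>'b\<close> the space of their components
  at a point. The summands are functions on all of \<open>'a\<close>, but the equality is asked on
  \<open>W\<close> only.\<close>

definition sum_of :: "(('a \<Rightarrow> 'b::comm_monoid_add) \<Rightarrow> bool) \<Rightarrow> 'a set \<Rightarrow> ('a \<Rightarrow> 'b) \<Rightarrow> bool" where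
  "sum_of P W F \<longleftrightarrow> (\<exists>Ts. (\<forall>T\<in>set Ts. P T) \<and> (\<forall>x\<in>W. F x = (\<Sum>T\<leftarrow>Ts. T x)))"

lemma sum_of_zero: "(\<And>x. x \<in> W \<Longrightarrow> F x = 0) \<Longrightarrow> sum_of P W F"
  unfolding sum_of_def by (intro exI[of _ "[]"]) simp

lemma sum_of_single: "P T \<Longrightarrow> sum_of P W T"
  unfolding sum_of_def by (intro exI[of _ "[T]"]) simp

lemma sum_of_add:
  assumes "sum_of P W F" "sum_of P W G"
  shows "sum_of P W (\<lambda>x. F x + G x)"
proof -
  obtain Ts Us where "\<forall>T\<in>set Ts. P T" "\<forall>x\<in>W. F x = (\<Sum>T\<leftarrow>Ts. T x)"
    "\<forall>T\<in>set Us. P T" "\<forall>x\<in>W. G x = (\<Sum>T\<leftarrow>Us. T x)"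
    using assms unfolding sum_of_def by blast
  then show ?thesis
    unfolding sum_of_def by (intro exI[of _ "Ts @ Us"]) auto
qed

lemma sum_of_sum: "(\<And>i. i \<in> I \<Longrightarrow> sum_of P W (F i)) \<Longrightarrow> sum_of P W (\<lambda>x. \<Sum>i\<in>I. F i x)"
  by (induction I rule: infinite_finite_induct) (auto intro: sum_of_zero sum_of_add)

lemma sum_of_cong: "sum_of P W F \<Longrightarrow> (\<And>x. x \<in> W \<Longrightarrow> G x = F x) \<Longrightarrow> sum_of P W G"
  unfolding sum_of_def by auto

text \<open>\<open>E\<close> embeds a coefficient additively at a fixed monomial and differential. A
  coefficient linear in the momenta yields one term for each momentum, a constant one a single term,
  and the rest none.\<close>

lemma sum_of_p_hom:
  fixes E :: "complex \<Rightarrow> 'b::comm_monoid_add"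
  assumes E: "\<And>a b. E (a + b) = E a + E b" "E 0 = 0" and g: "p_hom V w g"
    and lin: "\<And>f \<upsilon>. w = 0 \<Longrightarrow> smooth_on V f \<Longrightarrow> P (\<lambda>x. E (of_real (f (q_of x) * p_of x $ \<upsilon>)))"
    and const: "\<And>f. w = 1 \<Longrightarrow> smooth_on V f \<Longrightarrow> P (\<lambda>x. E (of_real (f (q_of x))))"
  shows "sum_of P (q_of -` V) (\<lambda>x. E (g x))"
proof (cases w rule: weight_cases)
  case 1
  obtain f where f: "\<And>\<upsilon>. smooth_on V (f \<upsilon>)"
      "\<And>x. q_of x \<in> V \<Longrightarrow> g x = of_real (\<Sum>\<upsilon>\<in>UNIV. f \<upsilon> (q_of x) * p_of x $ \<upsilon>)"
    using g unfolding 1 by (elim p_hom_0E) (rule that)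
  have sum: "E (sum h I) = (\<Sum>i\<in>I. E (h i))" for h :: "'a \<Rightarrow> complex" and I
    by (induction I rule: infinite_finite_induct) (simp_all add: E)
  have "sum_of P (q_of -` V) (\<lambda>x. \<Sum>\<upsilon>\<in>UNIV. E (of_real (f \<upsilon> (q_of x) * p_of x $ \<upsilon>)))"
    by (rule sum_of_sum, rule sum_of_single, rule lin[OF 1 f(1)])
  then show ?thesis
    by (rule sum_of_cong) (simp add: f sum)
next
  case 2
  obtain f where f: "smooth_on V f" "\<And>x. q_of x \<in> V \<Longrightarrow> g x = of_real (f (q_of x))"
    using g unfolding 2 by (elim p_hom_1E) (rule that)
  have "sum_of P (q_of -` V) (\<lambda>x. E (of_real (f (q_of x))))"
    by (rule sum_of_single, rule const[OF _ f(1)]) (simp add: 2)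
  then show ?thesis
    by (rule sum_of_cong) (simp add: f)
next
  case 3
  then show ?thesis
    using g E(2) by (intro sum_of_zero) (simp add: p_hom_ge_2)
qed

section \<open>Monomials of weight zero and one, and the admissible terms\<close>

lemma mset_weight_eq_0E:
  assumes "mset_weight M = 0"
  obtains N where "M = y_spatial N"
proof -
  have "\<exists>N. M = y_spatial N"
    using assms
  proof (induction M)
    case (add i M)
    then obtain N \<alpha> where "M = y_spatial N" "i = Inl \<alpha>"
      by (cases i) auto
    then have "add_mset i M = y_spatial (add_mset \<alpha> N)"
      by (simp add: y_spatial_def)
    then show ?case ..
  qed (simp add: y_spatial_def)
  then show ?thesis
    using that by blast
qed

lemma mset_weight_eq_1E:
  assumes "mset_weight M = 1"
  obtains N \<tau> where "M = y_spatial N + {#Inr \<tau>#}"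
proof -
  have "mset_weight M \<noteq> 0"
    using assms by simp
  then have "\<exists>i. i \<in># M \<and> p_weight i \<noteq> 0"
    unfolding mset_weight_def sum_mset_0_iff by auto
  then obtain \<tau> where "Inr \<tau> \<in># M"
    by (metis p_weight.simps(1) sum.exhaust)
  then obtain M' where M': "M = add_mset (Inr \<tau>) M'"
    by (metis insert_DiffM)
  then have "mset_weight M' = 0"
    using assms by simp
  then obtain N where "M' = y_spatial N"
    by (rule mset_weight_eq_0E)
  then show ?thesis
    using that M' by simp
qed

lemma size_y_spatial [simp]: "size (y_spatial N) = size N"
  by (simp add: y_spatial_def)

text \<open>The single unit of weight sits in the differential, in the monomial or in the
  coefficient. These three possibilities are the three kinds of terms.\<close>

lemma sum_of_series_terms:
  assumes g: "p_hom V (p_weight i + mset_weight M) g" and M: "size M = z + 1"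
  shows "sum_of (\<lambda>T. series_term_1 V z T \<or> series_term_2 V z T \<or> series_term_3 V z T) (q_of -` V)
    (\<lambda>x k. weyl_scale (g x * dx1 i k) (y_monomial M))"
  using g
proof (rule sum_of_p_hom[where E = "\<lambda>s k. weyl_scale (s * dx1 i k) (y_monomial M)", rotated 2],
    goal_cases)
  case (1 f \<upsilon>)
  then obtain N \<alpha> where "M = y_spatial N" "i = Inl \<alpha>"
    by (cases i) (auto elim: mset_weight_eq_0E)
  then show ?case
    using 1 M unfolding series_term_3_def by auto
next
  case (2 f)
  then consider \<alpha> where "i = Inr \<alpha>" "mset_weight M = 0" | \<alpha> where "i = Inl \<alpha>" "mset_weight M = 1"
    by (cases i) auto
  then show ?case
  proof cases
    case 1
    then obtain N where "M = y_spatial N"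
      by (elim mset_weight_eq_0E)
    then show ?thesis
      using 1 2 M unfolding series_term_1_def by auto
  next
    case (2 \<alpha>)
    then obtain N \<tau> where "M = y_spatial N + {#Inr \<tau>#}"
      by (elim mset_weight_eq_1E)
    then show ?thesis
      using 2 \<open>smooth_on V f\<close> M unfolding series_term_2_def by auto
  qed
qed (auto simp: weyl_scale_def fun_eq_iff algebra_simps)

text \<open>Again the unit of weight has three possible places; two momentum differentials would
  already have weight two.\<close>

lemma sum_of_curv_terms:
  assumes V: "open V" and g: "p_hom V (p_weight i + p_weight j + mset_weight M) g"
    and M: "size M = z"
  shows "sum_of (\<lambda>T. curv_term_1 V z T \<or> curv_term_2 V z T \<or> curv_term_3 V z T) (q_of -` V)
    (\<lambda>x k l. weyl_scale (g x * dx2 i j k l) (y_monomial M))"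
  using g
proof (rule sum_of_p_hom[where E = "\<lambda>s k l. weyl_scale (s * dx2 i j k l) (y_monomial M)", rotated 2],
    goal_cases)
  case (1 f \<upsilon>)
  then obtain N \<alpha> \<beta> where "M = y_spatial N" "i = Inl \<alpha>" "j = Inl \<beta>"
    by (cases i; cases j) (auto elim: mset_weight_eq_0E)
  then have "curv_term_3 V z
      (\<lambda>x k l. weyl_scale (of_real (f (q_of x) * p_of x $ \<upsilon>) * dx2 i j k l) (y_monomial M))"
    using 1 M unfolding curv_term_3_def
    by (intro exI[of _ f] exI[of _ N] exI[of _ \<upsilon>] exI[of _ \<alpha>] exI[of _ \<beta>]) simp
  then show ?case
    by (intro disjI2)
next
  case (2 f)
  then consider \<alpha> \<beta> where "i = Inl \<alpha>" "j = Inr \<beta>" "mset_weight M = 0"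
    | \<alpha> \<beta> where "i = Inr \<beta>" "j = Inl \<alpha>" "mset_weight M = 0"
    | \<alpha> \<beta> where "i = Inl \<alpha>" "j = Inl \<beta>" "mset_weight M = 1"
    by (cases i; cases j) auto
  then show ?case
  proof cases
    case 1
    then obtain N where "M = y_spatial N"
      by (elim mset_weight_eq_0E)
    then show ?thesis
      using 1 2 M unfolding curv_term_1_def by auto
  next
    case (2 \<alpha> \<beta>)
    then obtain N where N: "M = y_spatial N"
      by (elim mset_weight_eq_0E)
    \<comment> \<open>The differentials come in the order opposite to the listed form, and the sign
      is absorbed into the coefficient.\<close>
    have "smooth_on V (\<lambda>q. - f q)"
      using smooth_on_mult[OF V smooth_on_const \<open>smooth_on V f\<close>, of "- 1"] by simp
    moreover have "of_real (f (q_of x)) * dx2 i j k l =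
        of_real (- f (q_of x)) * dx2 (Inl \<alpha>) (Inr \<beta>) k l" for x k l
      by (simp add: dx2_def 2 algebra_simps)
    ultimately have "curv_term_1 V z
        (\<lambda>x k l. weyl_scale (of_real (f (q_of x)) * dx2 i j k l) (y_monomial M))"
      unfolding curv_term_1_def using N M
      by (intro exI[of _ "\<lambda>q. - f q"] exI[of _ N] exI[of _ \<alpha>] exI[of _ \<beta>]) (simp del: of_real_minus)
    then show ?thesis ..
  next
    case (3 \<alpha> \<beta>)
    then obtain N \<tau> where "M = y_spatial N + {#Inr \<tau>#}"
      by (elim mset_weight_eq_1E)
    then show ?thesis
      using 3 2 M unfolding curv_term_2_def
      by (intro disjI2 disjI1 exI[of _ f] exI[of _ N] exI[of _ \<tau>] exI[of _ \<alpha>] exI[of _ \<beta>]) simp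
  qed
qed (auto simp: weyl_scale_def fun_eq_iff algebra_simps)

text \<open>Without \<hbar> the degree is the size of the monomial, and finitely many indices give
  finitely many monomials of that size.\<close>

lemma degree_part_eq_sum:
  fixes a :: "'i::finite weyl"
  assumes "\<And>h M. 0 < h \<Longrightarrow> 2 * h + size M = d \<Longrightarrow> a h M = 0"
  shows "degree_part d a =
    (\<Sum>M\<in>multisets_of_size UNIV d. weyl_scale (a 0 M) (y_monomial M))"
proof (intro ext)
  fix h N
  have fin: "finite (multisets_of_size (UNIV :: 'i set) d)"
    by (rule finite_multisets_of_size) simp
  have "(\<Sum>M\<in>multisets_of_size UNIV d. weyl_scale (a 0 M) (y_monomial M)) h N =
      (\<Sum>M\<in>multisets_of_size UNIV d. if N = M then (if h = 0 then a 0 N else 0) else 0)"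
    unfolding sum_fun_apply by (intro sum.cong) (auto simp: weyl_scale_def y_monomial_def)
  then show "degree_part d a h N =
      (\<Sum>M\<in>multisets_of_size UNIV d. weyl_scale (a 0 M) (y_monomial M)) h N"
    using assms[of h N] fin by (auto simp: degree_part_def multisets_of_size_def)
qed

lemma abelian_curv_antisym: "abelian_curv g r x k j h M = - abelian_curv g r x j k h M"
  by (simp add: abelian_curv_eq wd_def algebra_simps)

text \<open>For antisymmetric \<open>a\<close> the right side is \<open>2 * a k l\<close>, since
  every pair of differentials is met in both orders.\<close>

lemma sum_dx2: "(\<Sum>i\<in>UNIV. \<Sum>j\<in>UNIV. a i j * dx2 i j k l) = a k l - a l k"
  for k l :: "'i::finite"
proof -
  have "a i j * dx2 i j k l = (if k = i then if l = j then a i j else 0 else 0) -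
      (if l = i then if k = j then a i j else 0 else 0)" for i j
    by (simp add: dx2_def dx1_def)
  then have "(\<Sum>j\<in>UNIV. a i j * dx2 i j k l) =
      (if k = i then a i l else 0) - (if l = i then a i k else 0)" for i
    by (simp add: sum_subtractf)
  then show ?thesis
    by (simp add: sum_subtractf)
qed

lemma sum_list_fun_apply: "(\<Sum>T\<leftarrow>Ts. F T) x = (\<Sum>T\<leftarrow>Ts. F T x)"
  by (induction Ts) simp_all

theorem mainTheorem7:
  fixes X :: "'m topology"
    and A :: "('m, 'n::finite) chart set"
    and \<Gamma> :: "('m, 'n) conn"
    and \<gamma> :: "('m \<times> ('m, 'n) covector, 'n + 'n) conn"
    and r :: "('m, 'n) cot_chart \<Rightarrow> ('n + 'n) wform1"
    and z :: nat
  assumes "smooth_manifold X A" and "paracompact_space X"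
    and "linear_connection A \<Gamma>" and "torsion_free A \<Gamma>"
    and "symplectic_connection A \<gamma>" and "compatible_connection A \<Gamma> \<gamma>"
    and "abelian_connection_series A \<gamma> r"
    and "z \<ge> 2"
  shows "\<forall>c\<in>A. let d = darboux_chart A c; V = chart_img c;
             R = abelian_curv (connection_form (\<gamma> d)) (r d) in
           ((\<forall>x\<in>chart_img d. \<forall>k l h M. h > 0 \<longrightarrow> degree_part z (R x k l) h M = 0) \<and>
            (\<exists>Ts. (\<forall>T\<in>set Ts. curv_term_1 V z T \<or> curv_term_2 V z T \<or> curv_term_3 V z T) \<and>
              (\<forall>x\<in>chart_img d. \<forall>k l. degree_part z (R x k l) = (\<Sum>T\<leftarrow>Ts. T x k l)))) \<and>
           (\<exists>Ts. (\<forall>T\<in>set Ts. series_term_1 V z T \<or> series_term_2 V z T \<or> series_term_3 V z T) \<and>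
              (\<forall>x\<in>chart_img d. \<forall>k. degree_part (z + 1) (r d x k) = (\<Sum>T\<leftarrow>Ts. T x k)))"
proof (intro ballI)
  fix c
  assume c: "c \<in> A"
  define d where "d = darboux_chart A c"
  define V where "V = chart_img c"
  define g where "g = connection_form (\<gamma> d)"
  define R where "R = abelian_curv g (r d)"
  have V: "open V"
    using smooth_manifoldD(1)[OF assms(1) c] by (simp add: V_def is_chart_def)
  have img: "chart_img d = q_of -` V"
    unfolding V_def d_def by (rule chart_img_darboux_chart[OF assms(1) c])
  have "d \<in> cot_atlas A"
    using c by (simp add: cot_atlas_def d_def)
  then have r: "wdelta (r d) x = R x" "wdelta_inv (r d) x = 0"
    "s < 3 \<Longrightarrow> degree_part s (r d x k) = 0" if "q_of x \<in> V" for x k s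
    using assms(7) that unfolding abelian_connection_series_def R_def g_def abelian_curv_def
    by (simp_all add: img Let_def)
  have r_low: "r d x k h M = 0" if "q_of x \<in> V" "2 * h + size M < 3" for x k h M
    using fun_cong[OF fun_cong[OF r(3)[OF that, of k]], of h M] by (simp add: degree_part_def)
  have g_low: "g x k h M = 0" if "2 * h + size M < 2" for x k h M
    using that by (simp add: g_def connection_form_low)
  have g_hom: "p_hom V (p_weight k + mset_weight M + 2 * h) (\<lambda>x. g x k h M)" for k h M
    unfolding g_def d_def V_def
    by (intro p_hom_connection_form p_hom_lowered[OF assms(1,3,5,6) c] V[unfolded V_def])
  have r_hom: "p_hom V (p_weight k + mset_weight M + 2 * h) (\<lambda>x. r d x k h M)" for k h M
    by (rule p_hom_abelian_series[OF V g_low r_low g_hom r(1)[unfolded R_def] r(2)])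
  have R_hom: "p_hom V (p_weight j + p_weight k + mset_weight M + 2 * h) (\<lambda>x. R x j k h M)"
    for j k h M
    unfolding R_def by (rule p_hom_abelian_curv[OF V g_low r_low g_hom r_hom refl])
  \<comment> \<open>A positive \<open>h\<close> already contributes at least \<open>2\<close> to the
    index in \<open>r_hom\<close>, where \<open>p_hom\<close> means vanishing.\<close>
  have r_hbar: "r d x k h M = 0" if "q_of x \<in> V" "0 < h" for x k h M
    using r_hom[of k M h] that by (simp add: p_hom_ge_2)
  have R_hbar: "R x j k h M = 0" if "q_of x \<in> V" "0 < h" for x j k h M
    using R_hom[of j k M h] that by (simp add: p_hom_ge_2)
  have "sum_of (\<lambda>T. series_term_1 V z T \<or> series_term_2 V z T \<or> series_term_3 V z T) (q_of -` V)
      (\<lambda>x. \<Sum>M\<in>multisets_of_size UNIV (z + 1). \<Sum>i\<in>UNIV.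
        (\<lambda>k. weyl_scale (r d x i 0 M * dx1 i k) (y_monomial M)))"
    using r_hom[of _ _ 0] by (intro sum_of_sum sum_of_series_terms) (auto simp: multisets_of_size_def)
  moreover have "(\<lambda>k. degree_part (z + 1) (r d x k)) =
      (\<Sum>M\<in>multisets_of_size UNIV (z + 1). \<Sum>i\<in>UNIV.
        (\<lambda>k. weyl_scale (r d x i 0 M * dx1 i k) (y_monomial M)))" if "q_of x \<in> V" for x
    by (intro ext, subst degree_part_eq_sum)
      (simp_all add: r_hbar that sum_fun_apply weyl_scale_def dx1_def if_distrib
        if_distribR sum_distrib_right cong: if_cong)
  ultimately have "sum_of (\<lambda>T. series_term_1 V z T \<or> series_term_2 V z T \<or> series_term_3 V z T)
      (q_of -` V) (\<lambda>x k. degree_part (z + 1) (r d x k))"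
    by (elim sum_of_cong) simp
  then have r_terms: "\<exists>Ts. (\<forall>T\<in>set Ts. series_term_1 V z T \<or> series_term_2 V z T \<or> series_term_3 V z T) \<and>
      (\<forall>x\<in>chart_img d. \<forall>k. degree_part (z + 1) (r d x k) = (\<Sum>T\<leftarrow>Ts. T x k))"
    unfolding sum_of_def img fun_eq_iff[where 'a = "'n + 'n" and 'b = "('n + 'n) weyl"]
      sum_list_fun_apply .
  \<comment> \<open>The sum runs over ordered pairs of differentials; the factor
    \<open>1 / 2\<close> compensates the double counting.\<close>
  have "sum_of (\<lambda>T. curv_term_1 V z T \<or> curv_term_2 V z T \<or> curv_term_3 V z T) (q_of -` V)
      (\<lambda>x. \<Sum>M\<in>multisets_of_size UNIV z. \<Sum>i\<in>UNIV. \<Sum>j\<in>UNIV.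
        (\<lambda>k l. weyl_scale (of_real (1 / 2) * R x i j 0 M * dx2 i j k l) (y_monomial M)))"
    using p_hom_scale[OF V R_hom[of _ _ _ 0], where s = "1 / 2"]
    by (intro sum_of_sum sum_of_curv_terms V) (auto simp: multisets_of_size_def)
  moreover have "(\<lambda>k l. degree_part z (R x k l)) =
      (\<Sum>M\<in>multisets_of_size UNIV z. \<Sum>i\<in>UNIV. \<Sum>j\<in>UNIV.
        (\<lambda>k l. weyl_scale (of_real (1 / 2) * R x i j 0 M * dx2 i j k l) (y_monomial M)))"
    if "q_of x \<in> V" for x
  proof (intro ext)
    fix k l h N
    have "(\<Sum>i\<in>UNIV. \<Sum>j\<in>UNIV. of_real (1 / 2) * R x i j 0 M * dx2 i j k l) = R x k l 0 M" for M
      using abelian_curv_antisym[of g "r d" x l k 0 M] unfolding sum_dx2 R_def by simp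
    then have "R x k l 0 M * s =
        (\<Sum>i\<in>UNIV. \<Sum>j\<in>UNIV. of_real (1 / 2) * R x i j 0 M * dx2 i j k l * s)" for M s
      by (simp only: sum_distrib_right[symmetric])
    then show "degree_part z (R x k l) h N = (\<Sum>M\<in>multisets_of_size UNIV z. \<Sum>i\<in>UNIV. \<Sum>j\<in>UNIV.
        (\<lambda>k l. weyl_scale (of_real (1 / 2) * R x i j 0 M * dx2 i j k l) (y_monomial M))) k l h N"
      by (subst degree_part_eq_sum)
        (simp_all add: R_hbar that sum_fun_apply weyl_scale_def)
  qed
  ultimately have "sum_of (\<lambda>T. curv_term_1 V z T \<or> curv_term_2 V z T \<or> curv_term_3 V z T)
      (q_of -` V) (\<lambda>x k l. degree_part z (R x k l))"
    by (elim sum_of_cong) simp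
  then obtain Ts where Ts: "\<forall>T\<in>set Ts. curv_term_1 V z T \<or> curv_term_2 V z T \<or> curv_term_3 V z T"
      "\<forall>x\<in>q_of -` V. (\<lambda>k l. degree_part z (R x k l)) = (\<Sum>T\<leftarrow>Ts. T x)"
    unfolding sum_of_def by blast
  have R_terms: "degree_part z (R x k l) = (\<Sum>T\<leftarrow>Ts. T x k l)" if "x \<in> chart_img d" for x k l
    using fun_cong[OF fun_cong[OF bspec[OF Ts(2) that[unfolded img]]], of k l]
    by (simp only: sum_list_fun_apply)
  have "\<forall>x\<in>chart_img d. \<forall>k l h M. h > 0 \<longrightarrow> degree_part z (R x k l) h M = 0"
    by (simp add: img degree_part_def R_hbar)
  then show "let d = darboux_chart A c; V = chart_img c;
             R = abelian_curv (connection_form (\<gamma> d)) (r d) in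
           ((\<forall>x\<in>chart_img d. \<forall>k l h M. h > 0 \<longrightarrow> degree_part z (R x k l) h M = 0) \<and>
            (\<exists>Ts. (\<forall>T\<in>set Ts. curv_term_1 V z T \<or> curv_term_2 V z T \<or> curv_term_3 V z T) \<and>
              (\<forall>x\<in>chart_img d. \<forall>k l. degree_part z (R x k l) = (\<Sum>T\<leftarrow>Ts. T x k l)))) \<and>
           (\<exists>Ts. (\<forall>T\<in>set Ts. series_term_1 V z T \<or> series_term_2 V z T \<or> series_term_3 V z T) \<and>
              (\<forall>x\<in>chart_img d. \<forall>k. degree_part (z + 1) (r d x k) = (\<Sum>T\<leftarrow>Ts. T x k)))"
    using Ts(1) R_terms r_terms unfolding Let_def R_def g_def d_def V_def by blast
qed

end
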